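(* For every $N\in\mathbb{N}$ let $A_N$ be chosen uniformly (i.e. with respect to the Haar probability measure) in the orthogonal group $\mathcal{O}(N)$. Embed $A_N$ in $\mathbb{R}^{\infty\times\infty}$ by padding it with zero rows and columns, and equip $\mathbb{R}^{\infty\times\infty}$ with the product topology. Let $(\beta_N)$ be a sequence of positive numbers such that $\beta_N\to\infty$ and $\beta_N=o(\sqrt{N})$. Then the sequence $\beta_N A_N$ satisfies a large deviation principle on $\mathbb{R}^{\infty\times\infty}$ with speed $\frac{N}{\beta_N^2}$ and good convex rate function $$J:\mathbb{R}^{\infty\times\infty}\to[0,\infty],\qquad J(A)=\frac12\|A\|_F^2.$$
   Context: $\mathcal{O}(N)$ is the group of real $N\times N$ matrices $A$ with $AA^\top=A^\top A=\operatorname{Id}_N$. $\|A\|_F^2=\sum_{i,j\in\mathbb{N}}a_{i,j}^2\in[0,\infty]$ is the squared Frobenius norm. Large deviation principle (LDP): for a topological space $\mathbb{X}$, a function $I:\mathbb{X}\to[0,\infty]$ is a rate function if it is lower semicontinuous, i.e. its sublevel sets $\{x: I(x)\le y\}$ are closed for all $y\ge 0$; it is a good rate function if these sets are moreover compact. A sequence of $\mathbb{X}$-valued random variables $X_N$ satisfies an LDP with speed $s_N\to\infty$ and rate function $I$ if $$\liminf_{N\to\infty}\frac{1}{s_N}\log\mathbb{P}(X_N\in O)\ge-\inf_{x\in O}I(x)\ \text{ for all open } O\subseteq\mathbb{X},\qquad \limsup_{N\to\infty}\frac{1}{s_N}\log\mathbb{P}(X_N\in C)\le-\inf_{x\in C}I(x)\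 \text{ for all closed } C\subseteq\mathbb{X}.$$ *)

theory Defs
  imports "HOL-Probability.Probability" "HOL-Library.Landau_Symbols" "Jordan_Normal_Form.Matrix"
begin

text \<open>The orthogonal group as a set of matrices. (The library predicate \<open>orthogonal_mat\<close> is weaker:
  it only asks the columns to be nonzero and pairwise orthogonal.)\<close>

definition orthogonal_group :: "nat \<Rightarrow> real mat set" where
  "orthogonal_group N =
     {A \<in> carrier_mat N N. A * transpose_mat A = 1\<^sub>m N \<and> transpose_mat A * A = 1\<^sub>m N}"

text \<open>\<open>\<real>\<^bsup>\<infinity>\<times>\<infinity>\<^esup>\<close> is the type \<^typ>\<open>nat \<times> nat \<Rightarrow> real\<close>, whose topology is the product topology.
  Rows and columns are numbered from 0.\<close>

definition pad_mat :: "real mat \<Rightarrow> nat \<times> nat \<Rightarrow> real" where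
  "pad_mat A = (\<lambda>(i, j). if i < dim_row A \<and> j < dim_col A then A $$ (i, j) else 0)"

text \<open>The Borel sigma-algebra of \<open>O(N)\<close>: matrices have no topology of their own in the library, so
  the one induced by the embedding \<^const>\<open>pad_mat\<close> is used; it is the usual topology of entrywise
  convergence.\<close>

definition borel_orthogonal :: "nat \<Rightarrow> real mat measure" where
  "borel_orthogonal N = vimage_algebra (orthogonal_group N) pad_mat borel"

text \<open>The Haar probability measure is the unique left-invariant Borel probability measure.\<close>

definition haar_orthogonal :: "nat \<Rightarrow> real mat measure \<Rightarrow> bool" where
  "haar_orthogonal N \<mu> \<longleftrightarrow>
     prob_space \<mu> \<and> sets \<mu> = sets (borel_orthogonal N) \<and>
     (\<forall>B\<in>orthogonal_group N. \<forall>S\<in>sets \<mu>. emeasure \<mu> ((\<lambda>A. B * A) ` S) = emeasure \<mu> S)"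

definition uniform_orthogonal :: "'w measure \<Rightarrow> nat \<Rightarrow> ('w \<Rightarrow> real mat) \<Rightarrow> bool" where
  "uniform_orthogonal M N A \<longleftrightarrow>
     A \<in> M \<rightarrow>\<^sub>M borel_orthogonal N \<and> haar_orthogonal N (distr M (borel_orthogonal N) A)"

text \<open>Sublevel sets are taken at finite levels only: at level \<open>\<infinity>\<close> the sublevel set is the whole
  space, which need not be compact.\<close>

definition rate_function :: "('a::topological_space \<Rightarrow> ennreal) \<Rightarrow> bool" where
  "rate_function I \<longleftrightarrow> (\<forall>y::real. y \<ge> 0 \<longrightarrow> closed {x. I x \<le> ennreal y})"

definition good_rate_function :: "('a::topological_space \<Rightarrow> ennreal) \<Rightarrow> bool" where
  "good_rate_function I \<longleftrightarrow>
     rate_function I \<and> (\<forall>y::real. y \<ge> 0 \<longrightarrow> compact {x. I x \<le> ennreal y})"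

text \<open>The logarithm of a probability; the library's \<^const>\<open>ln\<close> has \<open>ln 0 = 0\<close>.\<close>

definition log_prob :: "real \<Rightarrow> ereal" where
  "log_prob p = (if p = 0 then -\<infinity> else ereal (ln p))"

text \<open>Sequences are indexed by \<open>N \<ge> 1\<close>.  The random variables may live on different probability
  spaces.\<close>

definition satisfies_LDP ::
  "(nat \<Rightarrow> 'w measure) \<Rightarrow> (nat \<Rightarrow> 'w \<Rightarrow> 'a::topological_space) \<Rightarrow> (nat \<Rightarrow> real) \<Rightarrow> ('a \<Rightarrow> ennreal) \<Rightarrow> bool"
  where
  "satisfies_LDP M X s I \<longleftrightarrow>
     (\<forall>N\<ge>1. prob_space (M N) \<and> X N \<in> borel_measurable (M N)) \<and>
     filterlim s at_top sequentially \<and>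
     rate_function I \<and>
     (\<forall>U. open U \<longrightarrow>
        liminf (\<lambda>N. ereal (1 / s N) * log_prob (measure (M N) {w \<in> space (M N). X N w \<in> U}))
          \<ge> - enn2ereal (INF x\<in>U. I x)) \<and>
     (\<forall>C. closed C \<longrightarrow>
        limsup (\<lambda>N. ereal (1 / s N) * log_prob (measure (M N) {w \<in> space (M N). X N w \<in> C}))
          \<le> - enn2ereal (INF x\<in>C. I x))"

definition frobenius_sq :: "(nat \<times> nat \<Rightarrow> real) \<Rightarrow> ennreal" where
  "frobenius_sq A = (\<Sum>\<^sub>\<infinity>(i, j)\<in>UNIV. ennreal ((A (i, j))\<^sup>2))"

text \<open>Convexity for \<open>[0,\<infinity>]\<close>-valued functions; the library's \<^const>\<open>convex_on\<close> is for real-valued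
  functions on types of class \<^class>\<open>real_vector\<close>.\<close>

definition convex_matrix_fun :: "((nat \<times> nat \<Rightarrow> real) \<Rightarrow> ennreal) \<Rightarrow> bool" where
  "convex_matrix_fun I \<longleftrightarrow>
     (\<forall>A B. \<forall>t\<in>{0..1::real}.
        I (\<lambda>p. (1 - t) * A p + t * B p) \<le> ennreal (1 - t) * I A + ennreal t * I B)"

definition J :: "(nat \<times> nat \<Rightarrow> real) \<Rightarrow> ennreal" where
  "J A = 1 / 2 * frobenius_sq A"

end

theory Submission
  imports Defs "HOL-Real_Asymp.Real_Asymp"
begin

text \<open>The theorem follows from one asymptotic formula: for every matrix \<open>\<theta>\<close> with finitely many nonzero
  entries, the logarithm of the expectation of \<open>exp (t * h)\<close>, \<open>h = (\<Sum>ij. \<theta> ij * A ij)\<close>, at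
  \<open>t = N / \<beta>\<close> is \<open>t\<^sup>2 / (2 * N)\<close> times the squared norm of \<open>\<theta>\<close>, up to a factor \<open>1 + o(1)\<close>.
  In other words, on this scale a finite block of a Haar distributed orthogonal matrix has the
  exponential moments of independent Gaussian entries with variance \<open>1 / N\<close>. The limit is a
  differentiable function, so the argument of Gaertner and Ellis gives the large deviation
  principle: Chernoff bounds for half-spaces and a compactness argument for the upper bound
  (\<open>closed_set_bound\<close>), exponential tilting for the lower bound (\<open>open_set_bound\<close>).

  The formula is derived from left invariance alone. Rotating two rows \<open>a \<noteq> b\<close> of \<open>A\<close> leaves expectations
  unchanged; differentiating in the angle and summing over all pairs of rows gives
  \<open>(N - 1) * F' t = t * (V * F t - R t)\<close>
  for \<open>F t\<close> the expectation of \<open>exp (t * h)\<close>, where \<open>V\<close> is the squared norm of \<open>\<theta>\<close> and \<open>R t\<close> is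
  the expectation of \<open>exp (t * h)\<close> times a quadratic form in a finite block of \<open>A\<close>
  (\<open>mgf_rotation_identity\<close>). If \<open>\<theta>\<close> has a single nonzero entry, then \<open>R \<ge> 0\<close>, so that
  \<open>F t \<le> exp (t\<^sup>2 * V / (2 * (N - 1)))\<close> and an entry of \<open>A\<close> exceeds \<open>\<epsilon>\<close> only with
  probability exponentially small in \<open>N\<close>. For \<open>t\<close> of smaller order than \<open>N\<close> the weight
  \<open>exp (t * h)\<close> cannot compensate this, so for general \<open>\<theta>\<close> the term \<open>R\<close> is negligible compared
  to \<open>F\<close>; integrating the differential equation gives matching upper and lower bounds
  (\<open>mgf_bounds\<close>). The bound for a single entry also provides the exponential tightness that is
  needed because the product space has infinitely many coordinates.\<close>

section \<open>Differentiation under the integral and a Gaussian comparison\<close>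

text \<open>Only a bound near \<open>s0\<close> is asked for: the mean value theorem turns it into a constant that
  dominates the difference quotients, and the dominated convergence theorem does the rest.\<close>

lemma has_derivative_integral_bounded:
  fixes f f' :: "real \<Rightarrow> 'a \<Rightarrow> real"
  assumes "finite_measure M"
    and int: "\<And>s. integrable M (f s)"
    and meas: "f' s0 \<in> borel_measurable M"
    and der: "\<And>s x. \<bar>s - s0\<bar> < 1 \<Longrightarrow> x \<in> space M \<Longrightarrow> ((\<lambda>s. f s x) has_real_derivative f' s x) (at s)"
    and bnd: "\<And>s x. \<bar>s - s0\<bar> < 1 \<Longrightarrow> x \<in> space M \<Longrightarrow> \<bar>f' s x\<bar> \<le> K"
  shows "((\<lambda>s. \<integral>x. f s x \<partial>M) has_real_derivative (\<integral>x. f' s0 x \<partial>M)) (at s0)"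
proof -
  interpret finite_measure M by fact
  have "((\<lambda>s. ((\<integral>x. f s x \<partial>M) - (\<integral>x. f s0 x \<partial>M)) / (s - s0)) \<longlongrightarrow> (\<integral>x. f' s0 x \<partial>M)) (at s0)"
    unfolding tendsto_at_iff_sequentially comp_def
  proof (intro allI impI)
    fix X :: "nat \<Rightarrow> real"
    assume X: "\<forall>i. X i \<in> UNIV - {s0}" "X \<longlonglongrightarrow> s0"
    from X(2) have "\<forall>\<^sub>F n in sequentially. dist (X n) s0 < 1"
      by (rule tendstoD) simp
    then obtain n0 where n0: "\<And>n. n \<ge> n0 \<Longrightarrow> \<bar>X n - s0\<bar> < 1"
      by (auto simp: eventually_sequentially dist_real_def)
    have quot: "\<bar>(f (X (n + n0)) x - f s0 x) / (X (n + n0) - s0)\<bar> \<le> K" if x: "x \<in> space M" for n x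
    proof -
      let ?s = "X (n + n0)"
      have s: "\<bar>?s - s0\<bar> < 1" "?s \<noteq> s0" using n0[of "n + n0"] X(1) by auto
      have "norm (f ?s x - f s0 x) \<le> K * norm (?s - s0)"
      proof (rule field_differentiable_bound[of "{s0 - 1<..<s0 + 1}"])
        show "((\<lambda>s. f s x) has_field_derivative f' z x) (at z within {s0 - 1<..<s0 + 1})"
          if "z \<in> {s0 - 1<..<s0 + 1}" for z
          by (rule DERIV_subset[OF der]) (use that x in auto)
        show "norm (f' z x) \<le> K" if "z \<in> {s0 - 1<..<s0 + 1}" for z
          using bnd[of z x] that x by auto
      qed (use s in auto)
      then show ?thesis using s by (simp add: field_simps)
    qed
    have "(\<lambda>n. \<integral>x. (f (X (n + n0)) x - f s0 x) / (X (n + n0) - s0) \<partial>M)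
        \<longlonglongrightarrow> (\<integral>x. f' s0 x \<partial>M)"
    proof (rule integral_dominated_convergence[where w = "\<lambda>_. K"])
      show "AE x in M. (\<lambda>n. (f (X (n + n0)) x - f s0 x) / (X (n + n0) - s0)) \<longlonglongrightarrow> f' s0 x"
      proof (rule AE_I2)
        fix x assume x: "x \<in> space M"
        have "((\<lambda>s. (f s x - f s0 x) / (s - s0)) \<longlongrightarrow> f' s0 x) (at s0)"
          using der[of s0 x] x by (simp add: has_field_derivative_iff)
        from this[unfolded tendsto_at_iff_sequentially comp_def, rule_format, of "\<lambda>n. X (n + n0)"]
        show "(\<lambda>n. (f (X (n + n0)) x - f s0 x) / (X (n + n0) - s0)) \<longlonglongrightarrow> f' s0 x"
          using X LIMSEQ_ignore_initial_segment[OF X(2)] by auto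
      qed
    qed (use meas borel_measurable_integrable[OF int] quot in auto)
    then have "(\<lambda>n. ((\<integral>x. f (X (n + n0)) x \<partial>M) - (\<integral>x. f s0 x \<partial>M)) / (X (n + n0) - s0))
        \<longlonglongrightarrow> (\<integral>x. f' s0 x \<partial>M)"
      using int by simp
    then show "(\<lambda>n. ((\<integral>x. f (X n) x \<partial>M) - (\<integral>x. f s0 x \<partial>M)) / (X n - s0))
        \<longlonglongrightarrow> (\<integral>x. f' s0 x \<partial>M)"
      by (rule LIMSEQ_offset[where k = n0])
  qed
  then show ?thesis by (simp add: has_field_derivative_iff)
qed

text \<open>The hypothesis says that \<open>F t * exp (- c * t\<^sup>2 / 2)\<close> is nonincreasing on \<open>[0, T]\<close>; the right-hand
  side is the value at \<open>T\<close> of the solution of \<open>F' = c * t * F\<close>.\<close>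

lemma gaussian_gronwall_upper:
  fixes F F' :: "real \<Rightarrow> real"
  assumes der: "\<And>t. (F has_real_derivative F' t) (at t)"
    and le: "\<And>t. 0 \<le> t \<Longrightarrow> t \<le> T \<Longrightarrow> F' t \<le> c * t * F t"
    and T: "0 \<le> T"
  shows "F T \<le> F 0 * exp (c * T\<^sup>2 / 2)"
proof -
  let ?g = "\<lambda>t. F t * exp (- c * t\<^sup>2 / 2)"
  have "?g T \<le> ?g 0"
  proof (rule DERIV_nonpos_imp_nonincreasing[OF T])
    fix t assume t: "0 \<le> t" "t \<le> T"
    have "(?g has_real_derivative (F' t - c * t * F t) * exp (- c * t\<^sup>2 / 2)) (at t)"
      by (auto intro!: derivative_eq_intros der simp: algebra_simps)
    moreover have "(F' t - c * t * F t) * exp (- c * t\<^sup>2 / 2) \<le> 0"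
      using le[OF t] by (intro mult_nonpos_nonneg) auto
    ultimately show "\<exists>y. (?g has_real_derivative y) (at t) \<and> y \<le> 0" by blast
  qed
  then have "?g T * exp (c * T\<^sup>2 / 2) \<le> F 0 * exp (c * T\<^sup>2 / 2)"
    by (intro mult_right_mono) auto
  then show ?thesis by (simp add: mult.assoc flip: exp_add)
qed

lemma gaussian_gronwall_lower:
  fixes F F' :: "real \<Rightarrow> real"
  assumes der: "\<And>t. (F has_real_derivative F' t) (at t)"
    and ge: "\<And>t. 0 \<le> t \<Longrightarrow> t \<le> T \<Longrightarrow> c * t * F t \<le> F' t"
    and T: "0 \<le> T"
  shows "F 0 * exp (c * T\<^sup>2 / 2) \<le> F T"
  using gaussian_gronwall_upper[of "\<lambda>t. - F t" "\<lambda>t. - F' t" T c] assms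
  by (auto intro!: DERIV_minus)

section \<open>Half the squared norm as a good convex rate function\<close>

text \<open>The rate function for an arbitrary index set; for index pairs it is half the squared Frobenius norm.\<close>

definition half_sq_norm :: "('i \<Rightarrow> real) \<Rightarrow> ennreal" where
  "half_sq_norm x = 1 / 2 * (\<Sum>\<^sub>\<infinity>p\<in>UNIV. ennreal ((x p)\<^sup>2))"

text \<open>All probabilistic estimates below involve finitely many coordinates, so the rate function is
  approached through its finite partial sums.\<close>

lemma half_sq_norm_SUP:
  "half_sq_norm x = (SUP S\<in>{S. finite S}. ennreal ((\<Sum>p\<in>S. (x p)\<^sup>2) / 2))"
proof -
  have "half_sq_norm x = 1 / 2 * (SUP S\<in>{S. finite S}. (\<Sum>p\<in>S. ennreal ((x p)\<^sup>2)))"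
    unfolding half_sq_norm_def by (subst nonneg_infsum_complete) auto
  also have "\<dots> = (SUP S\<in>{S. finite S}. 1 / 2 * (\<Sum>p\<in>S. ennreal ((x p)\<^sup>2)))"
    by (rule SUP_mult_left_ennreal)
  also have "\<dots> = (SUP S\<in>{S. finite S}. ennreal ((\<Sum>p\<in>S. (x p)\<^sup>2) / 2))"
  proof (rule SUP_cong[OF refl])
    fix S :: "'a set"
    have "1 / 2 * (\<Sum>p\<in>S. ennreal ((x p)\<^sup>2)) = ennreal (\<Sum>p\<in>S. (x p)\<^sup>2) / 2"
      by (simp add: sum_ennreal ennreal_divide_times)
    also have "\<dots> = ennreal ((\<Sum>p\<in>S. (x p)\<^sup>2) / 2)"
      using divide_ennreal[of "\<Sum>p\<in>S. (x p)\<^sup>2" 2] by (simp add: sum_nonneg)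
    finally show "1 / 2 * (\<Sum>p\<in>S. ennreal ((x p)\<^sup>2)) = ennreal ((\<Sum>p\<in>S. (x p)\<^sup>2) / 2)" .
  qed
  finally show ?thesis .
qed

lemma half_sq_norm_le_iff:
  assumes "y \<ge> 0"
  shows "half_sq_norm x \<le> ennreal y \<longleftrightarrow> (\<forall>S. finite S \<longrightarrow> (\<Sum>p\<in>S. (x p)\<^sup>2) / 2 \<le> y)"
  unfolding half_sq_norm_SUP using assms by (simp add: SUP_le_iff)

lemma closed_half_sq_norm_sublevel:
  assumes "y \<ge> 0"
  shows "closed {x. half_sq_norm x \<le> ennreal y}"
proof -
  have "{x. half_sq_norm x \<le> ennreal y} = (\<Inter>S\<in>{S. finite S}. {x. (\<Sum>p\<in>S. (x p)\<^sup>2) / 2 \<le> y})"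
    using half_sq_norm_le_iff[OF assms] by auto
  also have "closed \<dots>"
    by (intro closed_INT ballI closed_Collect_le continuous_intros continuous_on_product_coordinates) auto
  finally show ?thesis .
qed

lemma compact_box:
  fixes R :: "'i \<Rightarrow> real"
  shows "compact {x. \<forall>p. \<bar>x p\<bar> \<le> R p}"
proof -
  have "compactin (product_topology (\<lambda>_. euclidean) UNIV) (PiE UNIV (\<lambda>p. {- R p..R p}))"
    by (subst compactin_PiE) auto
  moreover have "PiE UNIV (\<lambda>p. {- R p..R p}) = {x. \<forall>p. \<bar>x p\<bar> \<le> R p}"
    by (auto simp: PiE_iff abs_le_iff minus_le_iff)
  ultimately show ?thesis
    by (simp add: euclidean_product_topology)
qed

text \<open>Each coordinate of a point of a sublevel set is bounded, so the sublevel set is a closed part of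
  a box, and boxes are compact by the theorem of Tychonoff.\<close>

lemma good_rate_function_half_sq_norm: "good_rate_function (half_sq_norm :: ('i \<Rightarrow> real) \<Rightarrow> ennreal)"
  unfolding good_rate_function_def rate_function_def
proof (intro conjI allI impI)
  fix y :: real assume y: "y \<ge> 0"
  show "closed {x :: 'i \<Rightarrow> real. half_sq_norm x \<le> ennreal y}"
    by (rule closed_half_sq_norm_sublevel[OF y])
  have "\<bar>x p\<bar> \<le> sqrt (2 * y)" if "half_sq_norm x \<le> ennreal y" for x :: "'i \<Rightarrow> real" and p
  proof -
    have "(x p)\<^sup>2 / 2 \<le> y"
      using that[unfolded half_sq_norm_le_iff[OF y], rule_format, of "{p}"] by simp
    then show ?thesis by (intro real_le_rsqrt) simp
  qed
  then have "{x :: 'i \<Rightarrow> real. half_sq_norm x \<le> ennreal y} =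
      {x. \<forall>p. \<bar>x p\<bar> \<le> sqrt (2 * y)} \<inter> {x. half_sq_norm x \<le> ennreal y}"
    by auto
  also have "compact \<dots>"
    by (rule compact_Int_closed[OF compact_box closed_half_sq_norm_sublevel[OF y]])
  finally show "compact {x :: 'i \<Rightarrow> real. half_sq_norm x \<le> ennreal y}" .
qed

lemma half_sq_norm_convex:
  fixes x y :: "'i \<Rightarrow> real"
  assumes t: "t \<in> {0..1}"
  shows "half_sq_norm (\<lambda>p. (1 - t) * x p + t * y p)
    \<le> ennreal (1 - t) * half_sq_norm x + ennreal t * half_sq_norm y"
proof -
  have sq: "((1 - t) * a + t * b)\<^sup>2 \<le> (1 - t) * a\<^sup>2 + t * b\<^sup>2" for a b :: real
  proof -
    have "(1 - t) * a\<^sup>2 + t * b\<^sup>2 - ((1 - t) * a + t * b)\<^sup>2 = t * (1 - t) * (a - b)\<^sup>2"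
      by (simp add: power2_eq_square algebra_simps)
    moreover have "\<dots> \<ge> 0" using t by simp
    ultimately show ?thesis by linarith
  qed
  have le: "ennreal ((\<Sum>p\<in>S. (x p)\<^sup>2) / 2) \<le> half_sq_norm x" if "finite S" for S and x :: "'i \<Rightarrow> real"
    unfolding half_sq_norm_SUP by (rule SUP_upper) (use that in auto)
  show ?thesis
    unfolding half_sq_norm_SUP[of "\<lambda>p. (1 - t) * x p + t * y p"]
  proof (rule SUP_least)
    fix S :: "'i set" assume "S \<in> {S. finite S}"
    then have S: "finite S" by simp
    have "ennreal ((\<Sum>p\<in>S. ((1 - t) * x p + t * y p)\<^sup>2) / 2)
        \<le> ennreal ((1 - t) * ((\<Sum>p\<in>S. (x p)\<^sup>2) / 2) + t * ((\<Sum>p\<in>S. (y p)\<^sup>2) / 2))"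
    proof (rule ennreal_leI)
      have "(\<Sum>p\<in>S. ((1 - t) * x p + t * y p)\<^sup>2) \<le> (\<Sum>p\<in>S. (1 - t) * (x p)\<^sup>2 + t * (y p)\<^sup>2)"
        by (intro sum_mono sq)
      then show "(\<Sum>p\<in>S. ((1 - t) * x p + t * y p)\<^sup>2) / 2
          \<le> (1 - t) * ((\<Sum>p\<in>S. (x p)\<^sup>2) / 2) + t * ((\<Sum>p\<in>S. (y p)\<^sup>2) / 2)"
        by (simp add: sum.distrib sum_distrib_left)
    qed
    also have "\<dots> = ennreal (1 - t) * ennreal ((\<Sum>p\<in>S. (x p)\<^sup>2) / 2)
        + ennreal t * ennreal ((\<Sum>p\<in>S. (y p)\<^sup>2) / 2)"
      using t by (subst ennreal_plus) (auto intro!: sum_nonneg mult_nonneg_nonneg divide_nonneg_pos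
          simp: ennreal_mult' simp del: times_divide_eq_right)
    also have "\<dots> \<le> ennreal (1 - t) * half_sq_norm x + ennreal t * half_sq_norm y"
      by (intro add_mono mult_left_mono le S) auto
    finally show "ennreal ((\<Sum>p\<in>S. ((1 - t) * x p + t * y p)\<^sup>2) / 2)
        \<le> ennreal (1 - t) * half_sq_norm x + ennreal t * half_sq_norm y" .
  qed
qed

section \<open>Large deviations from quadratic exponential moments\<close>

lemma open_contains_box:
  fixes U :: "('i \<Rightarrow> real) set"
  assumes "open U" "x \<in> U"
  obtains S \<epsilon> where "finite S" "\<epsilon> > 0" "\<And>y. (\<And>p. p \<in> S \<Longrightarrow> \<bar>y p - x p\<bar> < \<epsilon>) \<Longrightarrow> y \<in> U"
proof -
  have "openin (product_topology (\<lambda>_. euclidean) UNIV) U"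
    using assms(1) by (simp add: euclidean_product_topology)
  from product_topology_open_contains_basis[OF this assms(2)]
  obtain B where B: "x \<in> PiE UNIV B" "\<And>p. open (B p)" "finite {p. B p \<noteq> UNIV}" "PiE UNIV B \<subseteq> U"
    by auto
  have "\<exists>e>0. \<forall>z. \<bar>z - x p\<bar> < e \<longrightarrow> z \<in> B p" for p
    using B(1) B(2)[of p] unfolding open_dist by (auto simp: dist_real_def PiE_iff)
  then obtain e where e: "\<And>p. e p > 0" "\<And>p z. \<bar>z - x p\<bar> < e p \<Longrightarrow> z \<in> B p"
    by metis
  define S where "S = {p. B p \<noteq> UNIV}"
  define \<epsilon> where "\<epsilon> = Min (insert 1 (e ` S))"
  have S: "finite S" using B(3) by (simp add: S_def)
  show thesis
  proof (rule that[OF S])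
    show "\<epsilon> > 0" using S e(1) by (auto simp: \<epsilon>_def)
    fix y assume y: "\<And>p. p \<in> S \<Longrightarrow> \<bar>y p - x p\<bar> < \<epsilon>"
    have "y p \<in> B p" for p
    proof (cases "p \<in> S")
      case True
      have "\<epsilon> \<le> e p" using True S by (auto simp: \<epsilon>_def)
      then show ?thesis using y[OF True] e(2)[of "y p" p] by linarith
    qed (auto simp: S_def)
    then show "y \<in> U" using B(4) by (auto simp: PiE_iff)
  qed
qed

lemma ereal_le_uminus_swap:
  fixes a b :: ereal
  shows "a \<le> - b \<Longrightarrow> b \<le> - a"
  by (cases a; cases b) auto

text \<open>The next two lemmas replace the logarithmic limits of the large deviation principle by plain
  exponential inequalities that hold from some \<open>N\<close> on.\<close>

lemma limsup_log_prob_le: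
  assumes s: "filterlim s at_top sequentially"
    and P: "\<forall>\<^sub>F N in sequentially. P N \<le> exp (- s N * \<alpha>)" and nonneg: "\<And>N. P N \<ge> 0"
  shows "limsup (\<lambda>N. ereal (1 / s N) * log_prob (P N)) \<le> - ereal \<alpha>"
proof (rule Limsup_bounded)
  have "\<forall>\<^sub>F N in sequentially. s N > 0"
    using s by (simp add: filterlim_at_top_dense)
  with P show "\<forall>\<^sub>F N in sequentially. ereal (1 / s N) * log_prob (P N) \<le> - ereal \<alpha>"
  proof eventually_elim
    case (elim N)
    show ?case
    proof (cases "P N = 0")
      case False
      then have "P N > 0" using nonneg[of N] by linarith
      then have "ln (P N) \<le> ln (exp (- s N * \<alpha>))"
        using elim(1) by (subst ln_le_cancel_iff) auto
      then show ?thesis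
        using False elim by (simp add: log_prob_def field_simps)
    qed (use elim in \<open>simp add: log_prob_def\<close>)
  qed
qed

lemma liminf_log_prob_ge:
  assumes s: "filterlim s at_top sequentially"
    and P: "\<forall>\<^sub>F N in sequentially. P N \<ge> exp (- s N * \<alpha>)"
  shows "liminf (\<lambda>N. ereal (1 / s N) * log_prob (P N)) \<ge> - ereal \<alpha>"
proof (rule Liminf_bounded)
  have "\<forall>\<^sub>F N in sequentially. s N > 0"
    using s by (simp add: filterlim_at_top_dense)
  with P show "\<forall>\<^sub>F N in sequentially. - ereal \<alpha> \<le> ereal (1 / s N) * log_prob (P N)"
  proof eventually_elim
    case (elim N)
    then have "P N > 0" using exp_gt_zero[of "- s N * \<alpha>"] by linarith
    then have "- s N * \<alpha> \<le> ln (P N)"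
      using elim(1) by (subst ln_ge_iff) auto
    then show ?case
      using \<open>P N > 0\<close> elim by (simp add: log_prob_def field_simps)
  qed
qed

text \<open>Chernoff's inequality.\<close>

lemma (in prob_space) prob_ge_le_exp_moment:
  fixes Y :: "'a \<Rightarrow> real"
  assumes int: "integrable M (\<lambda>w. exp (s * Y w))" and s: "s \<ge> 0"
    and [measurable]: "Y \<in> borel_measurable M"
  shows "prob {w \<in> space M. Y w \<ge> a} \<le> exp (- s * a) * (\<integral>w. exp (s * Y w) \<partial>M)"
proof -
  have "prob {w \<in> space M. Y w \<ge> a} = (\<integral>w. indicator {w \<in> space M. Y w \<ge> a} w \<partial>M)"
    by simp
  also have "\<dots> \<le> (\<integral>w. exp (- s * a) * exp (s * Y w) \<partial>M)"
  proof (rule integral_mono)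
    show "integrable M (\<lambda>w. exp (- s * a) * exp (s * Y w))"
      using int by simp
    show "indicator {w \<in> space M. Y w \<ge> a} w \<le> exp (- s * a) * exp (s * Y w)"
      if "w \<in> space M" for w
      using mult_left_mono[OF _ s, of a "Y w"] by (auto simp: indicator_def simp flip: exp_add)
  qed (simp add: less_top[symmetric])
  finally show ?thesis by simp
qed

text \<open>The hypotheses of the Gaertner--Ellis theorem for a limit that is the quadratic form of independent
  standard Gaussian coordinates. Assumption \<open>lim\<close> looks at finitely many coordinates at a time;
  \<open>entry\<close> holds uniformly over the infinitely many coordinates and provides exponential tightness.
  Its exponent \<open>c\<^sup>2\<close>, instead of the sharp \<open>c\<^sup>2 / 2\<close>, is enough for that purpose.\<close>

locale quadratic_exp_moments =
  fixes M :: "nat \<Rightarrow> 'w measure" and X :: "nat \<Rightarrow> 'w \<Rightarrow> 'i::countable \<Rightarrow> real" and s :: "nat \<Rightarrow> real"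
  assumes prob: "\<And>N. N \<ge> 1 \<Longrightarrow> prob_space (M N)"
    and meas: "\<And>N. N \<ge> 1 \<Longrightarrow> X N \<in> borel_measurable (M N)"
    and speed: "filterlim s at_top sequentially"
    and int: "\<And>N S \<theta>. N \<ge> 1 \<Longrightarrow> finite S \<Longrightarrow> integrable (M N) (\<lambda>w. exp (s N * (\<Sum>p\<in>S. \<theta> p * X N w p)))"
    and lim: "\<And>S \<theta>. finite S \<Longrightarrow>
      (\<lambda>N. ln (\<integral>w. exp (s N * (\<Sum>p\<in>S. \<theta> p * X N w p)) \<partial>M N) / s N) \<longlonglongrightarrow> (\<Sum>p\<in>S. (\<theta> p)\<^sup>2) / 2"
    and entry: "\<forall>\<^sub>F N in sequentially. \<forall>p c. (\<integral>w. exp (s N * (c * X N w p)) \<partial>M N) \<le> exp (s N * c\<^sup>2)"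
begin

lemma coordinate_measurable [measurable]:
  "N \<ge> 1 \<Longrightarrow> (\<lambda>w. X N w p) \<in> borel_measurable (M N)"
  using measurable_product_then_coordinatewise[OF meas] .

lemma eventually_speed_ge: "\<forall>\<^sub>F N in sequentially. s N \<ge> c"
  using speed by (simp add: filterlim_at_top)

lemma eventually_exp_speed_ge:
  assumes "\<eta> > 0"
  shows "\<forall>\<^sub>F N in sequentially. exp (s N * \<eta>) \<ge> c"
  using eventually_speed_ge[of "c / \<eta>"]
proof eventually_elim
  case (elim N)
  then have "c \<le> s N * \<eta>" using assms by (simp add: field_simps)
  then show ?case using exp_ge_add_one_self[of "s N * \<eta>"] by linarith
qed

lemma exp_moment_bounds:
  assumes S: "finite S" and eta: "\<eta> > 0"
  shows "\<forall>\<^sub>F N in sequentially.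
    exp (s N * ((\<Sum>p\<in>S. (\<theta> p)\<^sup>2) / 2 - \<eta>)) \<le> (\<integral>w. exp (s N * (\<Sum>p\<in>S. \<theta> p * X N w p)) \<partial>M N) \<and>
    (\<integral>w. exp (s N * (\<Sum>p\<in>S. \<theta> p * X N w p)) \<partial>M N) \<le> exp (s N * ((\<Sum>p\<in>S. (\<theta> p)\<^sup>2) / 2 + \<eta>))"
  using tendstoD[OF lim[OF S, of \<theta>] eta] eventually_speed_ge[of 1] eventually_ge_at_top[of 1]
proof eventually_elim
  case (elim N)
  interpret prob_space "M N" using prob elim by simp
  let ?L = "\<integral>w. exp (s N * (\<Sum>p\<in>S. \<theta> p * X N w p)) \<partial>M N"
  have "?L > 0"
  proof -
    have "?L \<noteq> 0"
      using int[OF elim(3) S, of \<theta>] by (subst integral_nonneg_eq_0_iff_AE) (auto simp: AE_False)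
    moreover have "?L \<ge> 0" by simp
    ultimately show ?thesis by linarith
  qed
  note exp_ln[OF this]
  moreover have "s N * ((\<Sum>p\<in>S. (\<theta> p)\<^sup>2) / 2 - \<eta>) \<le> ln ?L" and "ln ?L \<le> s N * ((\<Sum>p\<in>S. (\<theta> p)\<^sup>2) / 2 + \<eta>)"
    using elim by (auto simp: dist_real_def abs_less_iff field_simps)
  then have "exp (s N * ((\<Sum>p\<in>S. (\<theta> p)\<^sup>2) / 2 - \<eta>)) \<le> exp (ln ?L)"
      and "exp (ln ?L) \<le> exp (s N * ((\<Sum>p\<in>S. (\<theta> p)\<^sup>2) / 2 + \<eta>))"
    by (simp_all only: exp_le_cancel_iff)
  ultimately show ?case
    by (simp only:)
qed

text \<open>Exponential tightness. The radii of the box grow along an enumeration of the coordinates, so that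
  the Chernoff bounds of the single coordinates form a geometric series.\<close>

lemma tail_bound:
  "\<forall>\<^sub>F N in sequentially.
    measure (M N) {w \<in> space (M N). \<exists>p. \<bar>X N w p\<bar> > 2 * sqrt (L + 1 + to_nat p)} \<le> 2 * exp (- s N * L)"
  if L: "L \<ge> 0" for L :: real
  using entry eventually_speed_ge[of 1] eventually_ge_at_top[of 1]
proof eventually_elim
  case (elim N)
  interpret prob_space "M N" using prob elim by simp
  note [measurable] = coordinate_measurable[OF elim(3)]
  define R where "R = (\<lambda>p :: 'i. 2 * sqrt (L + 1 + to_nat p))"
  define A where "A = (\<lambda>n. {w \<in> space (M N). \<exists>p. to_nat p = n \<and> \<bar>X N w p\<bar> > R p})"
  \<comment> \<open>The exponential parameter \<open>R p / 2\<close> minimises the Chernoff exponent \<open>c\<^sup>2 - c * R p\<close>.\<close>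
  have one: "prob {w \<in> space (M N). c * X N w p \<ge> (R p)\<^sup>2 / 2} \<le> exp (- s N * (L + 1 + to_nat p))"
    if c: "c = R p / 2 \<or> c = - (R p / 2)" for c p
  proof -
    have R2: "(R p)\<^sup>2 = 4 * (L + 1 + to_nat p)" "c\<^sup>2 = L + 1 + to_nat p"
      using L c by (auto simp: R_def power_mult_distrib)
    have "prob {w \<in> space (M N). c * X N w p \<ge> (R p)\<^sup>2 / 2}
        \<le> exp (- s N * ((R p)\<^sup>2 / 2)) * (\<integral>w. exp (s N * (c * X N w p)) \<partial>M N)"
      using int[OF elim(3), of "{p}" "\<lambda>_. c"] elim
      by (intro prob_ge_le_exp_moment) auto
    also have "\<dots> \<le> exp (- s N * ((R p)\<^sup>2 / 2)) * exp (s N * c\<^sup>2)"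
      using elim by (intro mult_left_mono) auto
    also have "\<dots> = exp (- s N * (L + 1 + to_nat p))"
      unfolding R2 by (simp add: field_simps flip: exp_add)
    finally show ?thesis .
  qed
  have PA: "prob (A n) \<le> exp (- s N * L) * (1 / 2) ^ n" for n
  proof (cases "\<exists>p :: 'i. to_nat p = n")
    case True
    then obtain p :: 'i where p: "to_nat p = n" by auto
    have "A n \<subseteq> {w \<in> space (M N). R p / 2 * X N w p \<ge> (R p)\<^sup>2 / 2} \<union>
        {w \<in> space (M N). - (R p / 2) * X N w p \<ge> (R p)\<^sup>2 / 2}"
    proof
      fix w assume "w \<in> A n"
      then have w: "w \<in> space (M N)" "\<bar>X N w p\<bar> \<ge> R p"
        using p by (auto simp: A_def dest: injD[OF inj_to_nat, of _ p])
      have "R p \<ge> 0" by (simp add: R_def L)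
      then have "R p * R p \<le> R p * \<bar>X N w p\<bar>"
        using w by (intro mult_left_mono) auto
      then show "w \<in> {w \<in> space (M N). R p / 2 * X N w p \<ge> (R p)\<^sup>2 / 2} \<union>
        {w \<in> space (M N). - (R p / 2) * X N w p \<ge> (R p)\<^sup>2 / 2}"
        using w by (auto simp: power2_eq_square abs_if split: if_splits)
    qed
    then have "prob (A n) \<le> prob ({w \<in> space (M N). R p / 2 * X N w p \<ge> (R p)\<^sup>2 / 2} \<union>
        {w \<in> space (M N). - (R p / 2) * X N w p \<ge> (R p)\<^sup>2 / 2})"
      by (intro finite_measure_mono) auto
    also have "\<dots> \<le> exp (- s N * (L + 1 + n)) + exp (- s N * (L + 1 + n))"
      using one[of "R p / 2" p] one[of "- (R p / 2)" p] p
      by (intro order_trans[OF measure_Un_le] add_mono) auto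
    also have "\<dots> = 2 * exp (- s N * L) * exp (- s N * (1 + n))"
      by (simp add: algebra_simps flip: exp_add)
    also have "\<dots> \<le> 2 * exp (- s N * L) * (1 / 2) ^ (Suc n)"
    proof (intro mult_left_mono)
      have "1 * (1 + real n) \<le> s N * (1 + real n)"
        using elim(2) by (intro mult_right_mono) auto
      then have "exp (- s N * (1 + real n)) \<le> exp (- 1 * real (Suc n))"
        by (simp add: algebra_simps)
      also have "\<dots> = exp (- 1) ^ Suc n"
        by (metis exp_of_nat2_mult)
      also have "\<dots> \<le> (1 / 2) ^ Suc n"
      proof (rule power_mono)
        show "exp (- 1) \<le> (1 / 2 :: real)"
          using exp_ge_add_one_self[of "1 :: real"] by (simp add: exp_minus field_simps)
      qed simp
      finally show "exp (- s N * (1 + n)) \<le> (1 / 2) ^ Suc n" by simp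
    qed simp
    finally show ?thesis by simp
  next
    case False
    then have "A n = {}" by (auto simp: A_def)
    then show ?thesis by simp
  qed
  have geo: "(\<lambda>n. exp (- s N * L) * (1 / 2) ^ n) sums (exp (- s N * L) * 2)"
    using geometric_sums[of "1 / 2 :: real"] by (intro sums_mult) simp
  have [measurable]: "A n \<in> events" for n
    unfolding A_def by measurable
  have summ: "summable (\<lambda>n. prob (A n))"
    by (rule summable_comparison_test'[OF sums_summable[OF geo], of 0]) (use PA in auto)
  have "{w \<in> space (M N). \<exists>p. \<bar>X N w p\<bar> > 2 * sqrt (L + 1 + to_nat p)} = (\<Union>n. A n)"
    by (auto simp: A_def R_def)
  also have "prob \<dots> \<le> (\<Sum>n. prob (A n))"
    by (rule finite_measure_subadditive_countably[OF _ summ]) auto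
  also have "\<dots> \<le> (\<Sum>n. exp (- s N * L) * (1 / 2) ^ n)"
    by (rule suminf_le[OF PA summ sums_summable[OF geo]])
  also have "\<dots> = 2 * exp (- s N * L)"
    using sums_unique[OF geo] by simp
  finally show ?case .
qed

text \<open>Chernoff's inequality with the linear form \<open>x\<close> itself as exponent, which is optimal at the point
  \<open>x\<close>: the half-space contains \<open>x\<close> as soon as the rate of \<open>x\<close> exceeds \<open>\<alpha>\<close>.\<close>

lemma half_space_bound:
  assumes S: "finite S" and eta: "\<eta> > 0"
  shows "\<forall>\<^sub>F N in sequentially.
    measure (M N) {w \<in> space (M N). \<alpha> < (\<Sum>p\<in>S. x p * X N w p) - (\<Sum>p\<in>S. (x p)\<^sup>2) / 2}
      \<le> exp (- s N * (\<alpha> - \<eta>))"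
  using exp_moment_bounds[OF S eta, of x] eventually_speed_ge[of 0] eventually_ge_at_top[of 1]
proof eventually_elim
  case (elim N)
  interpret prob_space "M N" using prob elim by simp
  note [measurable] = coordinate_measurable[OF elim(3)]
  let ?v = "(\<Sum>p\<in>S. (x p)\<^sup>2) / 2"
  have "prob {w \<in> space (M N). \<alpha> < (\<Sum>p\<in>S. x p * X N w p) - ?v}
      \<le> prob {w \<in> space (M N). (\<Sum>p\<in>S. x p * X N w p) \<ge> \<alpha> + ?v}"
    by (intro finite_measure_mono) auto
  also have "\<dots> \<le> exp (- s N * (\<alpha> + ?v)) * (\<integral>w. exp (s N * (\<Sum>p\<in>S. x p * X N w p)) \<partial>M N)"
    using elim by (intro prob_ge_le_exp_moment int S) auto
  also have "\<dots> \<le> exp (- s N * (\<alpha> + ?v)) * exp (s N * (?v + \<eta>))"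
    using elim by (intro mult_left_mono) auto
  also have "\<dots> = exp (- s N * (\<alpha> - \<eta>))"
    by (simp add: algebra_simps flip: exp_add)
  finally show ?case .
qed

text \<open>Inside a large compact box, \<open>C\<close> is covered by finitely many of the half-spaces of
  \<open>half_space_bound\<close>; outside the box the probability is negligible by \<open>tail_bound\<close>. The gap
  between \<open>\<alpha>\<close> and \<open>\<alpha>'\<close> absorbs the number of half-spaces.\<close>

lemma closed_set_bound:
  assumes C: "closed C" and \<alpha>: "\<alpha> < \<alpha>'"
    and rate: "\<And>x. x \<in> C \<Longrightarrow> \<exists>S. finite S \<and> \<alpha>' < (\<Sum>p\<in>S. (x p)\<^sup>2) / 2"
  shows "\<forall>\<^sub>F N in sequentially. measure (M N) {w \<in> space (M N). X N w \<in> C} \<le> exp (- s N * \<alpha>)"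
proof -
  define \<eta> where "\<eta> = (\<alpha>' - \<alpha>) / 2"
  have eta: "\<eta> > 0" using \<alpha> by (simp add: \<eta>_def)
  from rate obtain S where S: "\<And>x. x \<in> C \<Longrightarrow> finite (S x)"
      "\<And>x. x \<in> C \<Longrightarrow> \<alpha>' < (\<Sum>p\<in>S x. (x p)\<^sup>2) / 2"
    by metis
  define V where "V = (\<lambda>x. {y. \<alpha>' < (\<Sum>p\<in>S x. x p * y p) - (\<Sum>p\<in>S x. (x p)\<^sup>2) / 2})"
  have "open (V x)" for x
    unfolding V_def by (intro open_Collect_less continuous_intros continuous_on_product_coordinates)
  define K :: "('i \<Rightarrow> real) set" where "K = {x. \<forall>p. \<bar>x p\<bar> \<le> 2 * sqrt (\<bar>\<alpha>'\<bar> + 1 + to_nat p)}"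
  have "compact (K \<inter> C)"
    unfolding K_def by (intro compact_Int_closed compact_box C)
  moreover have "K \<inter> C \<subseteq> (\<Union>x\<in>C. V x)"
  proof
    fix x assume "x \<in> K \<inter> C"
    then have "x \<in> V x"
      using S(2)[of x] by (simp add: V_def power2_eq_square)
    then show "x \<in> (\<Union>x\<in>C. V x)" using \<open>x \<in> K \<inter> C\<close> by auto
  qed
  ultimately obtain D where D: "D \<subseteq> C" "finite D" "K \<inter> C \<subseteq> (\<Union>x\<in>D. V x)"
    using \<open>\<And>x. open (V x)\<close> by (metis compactE_image)
  have "\<forall>\<^sub>F N in sequentially. \<forall>x\<in>D.
      measure (M N) {w \<in> space (M N). X N w \<in> V x} \<le> exp (- s N * (\<alpha>' - \<eta>))"
    unfolding V_def mem_Collect_eq using D(1)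
    by (intro eventually_ball_finite ballI D(2) half_space_bound S(1) eta) auto
  then show ?thesis
    using tail_bound[of "\<bar>\<alpha>'\<bar>", OF abs_ge_zero] eventually_exp_speed_ge[OF eta, of "real (card D) + 2"]
      eventually_speed_ge[of 0] eventually_ge_at_top[of 1]
  proof eventually_elim
    case (elim N)
    interpret prob_space "M N" using prob elim by simp
    note [measurable] = meas[OF elim(5)] coordinate_measurable[OF elim(5)]
    have V_meas: "{w \<in> space (M N). X N w \<in> V x} \<in> events" for x
      using measurable_sets[OF meas[OF elim(5)], of "V x"] \<open>open (V x)\<close>
      by (simp add: vimage_def Int_def conj_commute)
    define T where "T = {w \<in> space (M N). \<exists>p. \<bar>X N w p\<bar> > 2 * sqrt (\<bar>\<alpha>'\<bar> + 1 + to_nat p)}"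
    have T_meas: "T \<in> events"
      unfolding T_def by measurable
    have "{w \<in> space (M N). X N w \<in> C} \<subseteq> (\<Union>x\<in>D. {w \<in> space (M N). X N w \<in> V x}) \<union> T"
      using D(3) by (auto simp: K_def T_def not_less[symmetric])
    then have "prob {w \<in> space (M N). X N w \<in> C}
        \<le> prob ((\<Union>x\<in>D. {w \<in> space (M N). X N w \<in> V x}) \<union> T)"
      using D(2) V_meas T_meas by (intro finite_measure_mono sets.Un sets.finite_UN) auto
    also have "\<dots> \<le> prob (\<Union>x\<in>D. {w \<in> space (M N). X N w \<in> V x}) + prob T"
      using D(2) V_meas T_meas by (intro measure_Un_le sets.finite_UN) auto
    also have "\<dots> \<le> (\<Sum>x\<in>D. prob {w \<in> space (M N). X N w \<in> V x}) + prob T"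
      using D(2) V_meas by (intro add_right_mono finite_measure_subadditive_finite) auto
    also have "\<dots> \<le> (\<Sum>x\<in>D. exp (- s N * (\<alpha>' - \<eta>))) + 2 * exp (- s N * \<bar>\<alpha>'\<bar>)"
      using elim by (intro add_mono sum_mono) (auto simp: T_def)
    also have "\<dots> \<le> (\<Sum>x\<in>D. exp (- s N * (\<alpha>' - \<eta>))) + 2 * exp (- s N * (\<alpha>' - \<eta>))"
    proof -
      have "s N * (\<alpha>' - \<eta>) \<le> s N * \<bar>\<alpha>'\<bar>"
        using elim eta by (intro mult_left_mono) auto
      then show ?thesis by simp
    qed
    also have "\<dots> = (real (card D) + 2) * exp (- s N * (\<alpha>' - \<eta>))"
      by (simp add: algebra_simps)
    also have "\<dots> \<le> exp (s N * \<eta>) * exp (- s N * (\<alpha>' - \<eta>))"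
      using elim by (intro mult_right_mono) auto
    also have "\<dots> = exp (- s N * \<alpha>)"
      by (simp add: \<eta>_def algebra_simps add_divide_distrib diff_divide_distrib flip: exp_add)
    finally show ?case .
  qed
qed

text \<open>The classical change of measure. Under the density proportional to \<open>exp (s N * Y)\<close> with
  \<open>Y = (\<Sum>q\<in>S. x q * X N w q)\<close> the vector \<open>X N\<close> concentrates near \<open>x\<close>: tilting further by
  \<open>\<plusminus>\<epsilon>\<close> in one coordinate changes the quadratic limit by only \<open>\<epsilon>\<^sup>2 / 2\<close> beyond the linear term, while
  leaving the box of radius \<open>\<epsilon>\<close> around \<open>x\<close> costs \<open>\<epsilon>\<^sup>2\<close>. So almost the whole exponential moment
  \<open>exp (s N * v)\<close> of \<open>Y\<close> comes from the box, where \<open>Y\<close> is about \<open>2 * v\<close>; hence the box has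
  probability at least about \<open>exp (- s N * v)\<close>. No normalised tilted measure is introduced: the
  argument is the pointwise inequality \<open>point\<close> and its integral.\<close>

lemma open_set_bound:
  assumes U: "open U" "x \<in> U" and j: "\<And>S. finite S \<Longrightarrow> (\<Sum>p\<in>S. (x p)\<^sup>2) / 2 \<le> j"
    and kappa: "\<kappa> > 0"
  shows "\<forall>\<^sub>F N in sequentially. exp (- s N * (j + \<kappa>)) \<le> measure (M N) {w \<in> space (M N). X N w \<in> U}"
proof -
  obtain S \<epsilon>\<^sub>0 where S: "finite S" and eps0: "\<epsilon>\<^sub>0 > 0"
    and box: "\<And>y. (\<And>p. p \<in> S \<Longrightarrow> \<bar>y p - x p\<bar> < \<epsilon>\<^sub>0) \<Longrightarrow> y \<in> U"
    using open_contains_box[OF U] by metis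
  define c where "c = (\<Sum>p\<in>S. \<bar>x p\<bar>)"
  define v where "v = (\<Sum>p\<in>S. (x p)\<^sup>2) / 2"
  have c: "c \<ge> 0" by (simp add: c_def sum_nonneg)
  \<comment> \<open>The last two entries keep the total loss \<open>2 * \<eta> + \<epsilon> * c\<close> below \<open>\<kappa>\<close>.\<close>
  define \<epsilon> where "\<epsilon> = Min {\<epsilon>\<^sub>0, 1, \<kappa>, \<kappa> / (2 * (c + 1))}"
  have eps: "\<epsilon> > 0" "\<epsilon> \<le> \<epsilon>\<^sub>0" "\<epsilon> \<le> 1" "\<epsilon> \<le> \<kappa>" "\<epsilon> \<le> \<kappa> / (2 * (c + 1))"
    using eps0 kappa c by (auto simp: \<epsilon>_def)
  have eps_c: "\<epsilon> * c \<le> \<kappa> / 2"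
  proof -
    have "\<epsilon> * c \<le> \<epsilon> * (c + 1)" using eps by simp
    also have "\<dots> \<le> \<kappa> / 2" using eps(5) c by (simp add: field_simps)
    finally show ?thesis .
  qed
  \<comment> \<open>Leaving the box gains \<open>\<epsilon>\<^sup>2 / 2 = 4 * \<eta>\<close> in the exponent, against two errors of size \<open>\<eta>\<close>.\<close>
  define \<eta> where "\<eta> = \<epsilon>\<^sup>2 / 8"
  have eta: "\<eta> > 0" using eps by (simp add: \<eta>_def)
  have "\<epsilon>\<^sup>2 \<le> \<kappa>"
    using mult_mono[of \<epsilon> 1 \<epsilon> \<kappa>] eps kappa by (simp add: power2_eq_square)
  then have eta_c: "2 * \<eta> + \<epsilon> * c \<le> \<kappa>"
    using eps_c kappa by (simp add: \<eta>_def)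
  define tilt where "tilt = (\<lambda>p e q. x q + (if q = p then e else 0))"
  have tilt_sq: "(\<Sum>q\<in>S. (tilt p e q)\<^sup>2) / 2 = v + e * x p + e\<^sup>2 / 2" if "p \<in> S" for p e
  proof -
    have "(\<Sum>q\<in>S. (tilt p e q)\<^sup>2) = (\<Sum>q\<in>S. (x q)\<^sup>2 + (if q = p then 2 * e * x p + e\<^sup>2 else 0))"
      by (intro sum.cong) (auto simp: tilt_def power2_eq_square algebra_simps)
    then show ?thesis
      using that S by (simp add: sum.distrib v_def field_simps)
  qed
  have tilt_sum: "(\<Sum>q\<in>S. tilt p e q * y q) = (\<Sum>q\<in>S. x q * y q) + e * y p" if "p \<in> S" for p e y
  proof -
    have "(\<Sum>q\<in>S. tilt p e q * y q) = (\<Sum>q\<in>S. x q * y q + (if q = p then e * y p else 0))"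
      by (intro sum.cong) (auto simp: tilt_def algebra_simps)
    then show ?thesis
      using that S by (simp add: sum.distrib)
  qed
  have "\<forall>\<^sub>F N in sequentially. \<forall>p\<in>S. \<forall>e\<in>{\<epsilon>, - \<epsilon>}.
      (\<integral>w. exp (s N * (\<Sum>q\<in>S. tilt p e q * X N w q)) \<partial>M N) \<le> exp (s N * (v + e * x p + e\<^sup>2 / 2 + \<eta>))"
  proof (intro eventually_ball_finite ballI S)
    fix p e assume p: "p \<in> S"
    show "\<forall>\<^sub>F N in sequentially.
      (\<integral>w. exp (s N * (\<Sum>q\<in>S. tilt p e q * X N w q)) \<partial>M N) \<le> exp (s N * (v + e * x p + e\<^sup>2 / 2 + \<eta>))"
      using exp_moment_bounds[OF S eta, of "tilt p e"]
      by eventually_elim (simp add: tilt_sq[OF p])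
  qed auto
  then show ?thesis
    using exp_moment_bounds[OF S eta, of x] eventually_exp_speed_ge[OF eta, of "1 + 2 * real (card S)"]
      eventually_speed_ge[of 0] eventually_ge_at_top[of 1]
  proof eventually_elim
    case (elim N)
    interpret prob_space "M N" using prob elim by simp
    note [measurable] = meas[OF elim(5)] coordinate_measurable[OF elim(5)]
    define Y where "Y = (\<lambda>w. \<Sum>q\<in>S. x q * X N w q)"
    define B where "B = {w \<in> space (M N). \<forall>p\<in>S. \<bar>X N w p - x p\<bar> < \<epsilon>}"
    have [measurable]: "B \<in> events"
      unfolding B_def using S by measurable
    define E where "E = (\<lambda>p e w. exp (- s N * (e * x p + \<epsilon>\<^sup>2)) * exp (s N * (\<Sum>q\<in>S. tilt p e q * X N w q)))"
    have E_eq: "E p e w = exp (s N * (Y w + (e * (X N w p - x p) - \<epsilon>\<^sup>2)))" if "p \<in> S" for p e w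
      unfolding E_def Y_def tilt_sum[OF that] by (simp add: algebra_simps flip: exp_add)
    have E_nonneg: "E p e w \<ge> 0" for p e w by (simp add: E_def)
    have E_int: "integrable (M N) (E p e)" for p e
      unfolding E_def using int[OF elim(5) S, of "tilt p e"] by simp
    have E_le: "(\<integral>w. E p e w \<partial>M N) \<le> exp (s N * (v - 3 * \<eta>))" if "p \<in> S" "e \<in> {\<epsilon>, - \<epsilon>}" for p e
    proof -
      have e2: "e\<^sup>2 = 8 * \<eta>" "\<epsilon>\<^sup>2 = 8 * \<eta>" using that by (auto simp: \<eta>_def)
      have "(\<integral>w. E p e w \<partial>M N)
          = exp (- s N * (e * x p + \<epsilon>\<^sup>2)) * (\<integral>w. exp (s N * (\<Sum>q\<in>S. tilt p e q * X N w q)) \<partial>M N)"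
        by (simp add: E_def)
      also have "\<dots> \<le> exp (- s N * (e * x p + \<epsilon>\<^sup>2)) * exp (s N * (v + e * x p + e\<^sup>2 / 2 + \<eta>))"
        using elim(1)[rule_format, OF that] by (rule mult_left_mono) simp
      also have "\<dots> = exp (s N * (v - 3 * \<eta>))"
        unfolding e2 by (simp add: algebra_simps flip: exp_add)
      finally show ?thesis .
    qed
    have point: "exp (s N * Y w) \<le> exp (s N * (2 * v + \<epsilon> * c)) * indicator B w
        + (\<Sum>p\<in>S. E p \<epsilon> w + E p (- \<epsilon>) w)" if w: "w \<in> space (M N)" for w
    proof (cases "w \<in> B")
      case True
      have "Y w \<le> (\<Sum>q\<in>S. (x q)\<^sup>2 + \<epsilon> * \<bar>x q\<bar>)"
        unfolding Y_def
      proof (rule sum_mono)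
        fix q assume q: "q \<in> S"
        have "x q * (X N w q - x q) \<le> \<bar>x q\<bar> * \<bar>X N w q - x q\<bar>"
          by (metis abs_ge_self abs_mult)
        also have "\<dots> \<le> \<bar>x q\<bar> * \<epsilon>"
          using True q by (intro mult_left_mono) (auto simp: B_def less_imp_le)
        finally show "x q * X N w q \<le> (x q)\<^sup>2 + \<epsilon> * \<bar>x q\<bar>"
          by (simp add: power2_eq_square algebra_simps)
      qed
      also have "\<dots> = 2 * v + \<epsilon> * c"
        by (simp add: v_def c_def sum.distrib flip: sum_distrib_left)
      finally have "exp (s N * Y w) \<le> exp (s N * (2 * v + \<epsilon> * c)) * indicator B w"
        using True elim(4) by (simp add: mult_left_mono)
      then show ?thesis
        by (rule order_trans) (simp add: sum_nonneg E_nonneg)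
    next
      case False
      then obtain p where p: "p \<in> S" "\<bar>X N w p - x p\<bar> \<ge> \<epsilon>"
        using w by (auto simp: B_def not_less)
      define e where "e = (if X N w p \<ge> x p then \<epsilon> else - \<epsilon>)"
      have "e * (X N w p - x p) = \<epsilon> * \<bar>X N w p - x p\<bar>"
        by (simp add: e_def abs_if algebra_simps)
      also have "\<dots> \<ge> \<epsilon>\<^sup>2"
        using p(2) eps(1) by (simp add: power2_eq_square)
      finally have "exp (s N * Y w) \<le> E p e w"
        unfolding E_eq[OF p(1)] using elim(4) by (simp add: mult_left_mono)
      also have "\<dots> \<le> E p \<epsilon> w + E p (- \<epsilon>) w"
        using E_nonneg by (simp add: e_def)
      also have "\<dots> \<le> (\<Sum>p\<in>S. E p \<epsilon> w + E p (- \<epsilon>) w)"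
        by (rule member_le_sum[OF p(1)]) (use S E_nonneg in auto)
      also have "\<dots> \<le> exp (s N * (2 * v + \<epsilon> * c)) * indicator B w + \<dots>"
        by simp
      finally show ?thesis .
    qed
    have "exp (s N * (v - \<eta>)) \<le> (\<integral>w. exp (s N * Y w) \<partial>M N)"
      using elim(2) by (simp add: v_def Y_def)
    also have "\<dots> \<le> (\<integral>w. exp (s N * (2 * v + \<epsilon> * c)) * indicator B w
        + (\<Sum>p\<in>S. E p \<epsilon> w + E p (- \<epsilon>) w) \<partial>M N)"
      using int[OF elim(5) S, of x] E_int
      by (intro integral_mono point) (auto simp: Y_def less_top[symmetric])
    also have "\<dots> = exp (s N * (2 * v + \<epsilon> * c)) * prob B
        + (\<Sum>p\<in>S. (\<integral>w. E p \<epsilon> w \<partial>M N) + (\<integral>w. E p (- \<epsilon>) w \<partial>M N))"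
      using E_int by (simp add: less_top[symmetric])
    also have "\<dots> \<le> exp (s N * (2 * v + \<epsilon> * c)) * prob B
        + (\<Sum>p\<in>S. exp (s N * (v - 3 * \<eta>)) + exp (s N * (v - 3 * \<eta>)))"
      by (intro add_left_mono sum_mono add_mono E_le) auto
    finally have main: "exp (s N * (v - \<eta>))
        \<le> exp (s N * (2 * v + \<epsilon> * c)) * prob B + 2 * real (card S) * exp (s N * (v - 3 * \<eta>))"
      by simp
    have "exp (s N * (v - 2 * \<eta>)) + 2 * real (card S) * exp (s N * (v - 3 * \<eta>))
        \<le> exp (s N * (v - 2 * \<eta>)) + 2 * real (card S) * exp (s N * (v - 2 * \<eta>))"
      using elim(4) eta by (intro add_left_mono mult_left_mono) (auto intro: mult_left_mono)
    also have "\<dots> = (1 + 2 * real (card S)) * exp (s N * (v - 2 * \<eta>))"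
      by (simp add: algebra_simps)
    also have "\<dots> \<le> exp (s N * \<eta>) * exp (s N * (v - 2 * \<eta>))"
      using elim(3) by (intro mult_right_mono) auto
    also have "\<dots> = exp (s N * (v - \<eta>))"
      by (simp add: algebra_simps flip: exp_add)
    finally have low: "exp (s N * (v - 2 * \<eta>)) \<le> exp (s N * (2 * v + \<epsilon> * c)) * prob B"
      using main by linarith
    have "exp (- s N * (j + \<kappa>)) \<le> exp (- s N * (v + 2 * \<eta> + \<epsilon> * c))"
    proof -
      have "s N * (v + 2 * \<eta> + \<epsilon> * c) \<le> s N * (j + \<kappa>)"
        using elim(4) j[OF S] eta_c by (intro mult_left_mono) (auto simp: v_def)
      then show ?thesis by simp
    qed
    also have "\<dots> = exp (- s N * (2 * v + \<epsilon> * c)) * exp (s N * (v - 2 * \<eta>))"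
      by (simp add: algebra_simps flip: exp_add)
    also have "\<dots> \<le> exp (- s N * (2 * v + \<epsilon> * c)) * (exp (s N * (2 * v + \<epsilon> * c)) * prob B)"
      by (intro mult_left_mono low) simp
    also have "\<dots> = prob B"
      by (simp add: mult.assoc[symmetric] flip: exp_add)
    also have "\<dots> \<le> prob {w \<in> space (M N). X N w \<in> U}"
    proof (rule finite_measure_mono)
      show "B \<subseteq> {w \<in> space (M N). X N w \<in> U}"
        using eps(2) by (auto simp: B_def intro!: box)
      show "{w \<in> space (M N). X N w \<in> U} \<in> events"
        using measurable_sets[OF meas[OF elim(5)], of U] U(1)
        by (simp add: vimage_def Int_def conj_commute)
    qed
    finally show ?case .
  qed
qed

theorem satisfies_LDP_half_sq_norm: "satisfies_LDP M X s half_sq_norm"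
  unfolding satisfies_LDP_def
proof (intro conjI allI impI)
  show "prob_space (M N)" "X N \<in> borel_measurable (M N)" if "1 \<le> N" for N
    using prob[OF that] meas[OF that] .
  show "filterlim s at_top sequentially"
    by (rule speed)
  show "rate_function (half_sq_norm :: ('i \<Rightarrow> real) \<Rightarrow> ennreal)"
    by (rule good_rate_function_half_sq_norm[unfolded good_rate_function_def, THEN conjunct1])
  fix C :: "('i \<Rightarrow> real) set" assume C: "closed C"
  let ?l = "limsup (\<lambda>N. ereal (1 / s N) * log_prob (measure (M N) {w \<in> space (M N). X N w \<in> C}))"
  have "enn2ereal (INF x\<in>C. half_sq_norm x) \<le> - ?l"
  proof (rule dense_le)
    fix y assume y: "y < enn2ereal (INF x\<in>C. half_sq_norm x)"
    show "y \<le> - ?l"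
    proof (cases y)
      case (real \<alpha>)
      \<comment> \<open>An intermediate level leaves room for the subexponential factors of \<open>closed_set_bound\<close>.\<close>
      obtain z where z: "y < z" "z < enn2ereal (INF x\<in>C. half_sq_norm x)"
        using dense[OF y] by auto
      then obtain \<alpha>' where \<alpha>': "z = ereal \<alpha>'"
        using real by (cases z) auto
      have rate: "\<exists>S. finite S \<and> \<alpha>' < (\<Sum>p\<in>S. (x p)\<^sup>2) / 2" if "x \<in> C" for x
      proof (cases "\<alpha>' \<ge> 0")
        case True
        have "ennreal \<alpha>' < (INF x\<in>C. half_sq_norm x)"
          using z(2) True by (simp add: \<alpha>' less_ennreal.rep_eq enn2ereal_ennreal)
        also have "\<dots> \<le> half_sq_norm x"
          using that by (rule INF_lower)
        finally show ?thesis
          using half_sq_norm_le_iff[OF True, of x] by (auto simp: not_le[symmetric])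
      next
        case False
        then show ?thesis by (intro exI[of _ "{}"]) auto
      qed
      have "\<forall>\<^sub>F N in sequentially. measure (M N) {w \<in> space (M N). X N w \<in> C} \<le> exp (- s N * \<alpha>)"
        using z(1) real \<alpha>' by (intro closed_set_bound[OF C, of \<alpha> \<alpha>'] rate) auto
      then have "?l \<le> - ereal \<alpha>"
        by (intro limsup_log_prob_le[OF speed]) auto
      then show ?thesis
        unfolding real by (rule ereal_le_uminus_swap)
    qed (use y in auto)
  qed
  then show "?l \<le> - enn2ereal (INF x\<in>C. half_sq_norm x)"
    by (rule ereal_le_uminus_swap)
next
  fix U :: "('i \<Rightarrow> real) set" assume U: "open U"
  let ?l = "liminf (\<lambda>N. ereal (1 / s N) * log_prob (measure (M N) {w \<in> space (M N). X N w \<in> U}))"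
  have le: "- ?l \<le> enn2ereal (half_sq_norm x)" if x: "x \<in> U" for x
  proof (cases "half_sq_norm x" rule: ennreal_cases)
    case (real j)
    have "- ?l \<le> ereal j + ereal \<kappa>" if \<kappa>: "\<kappa> > 0" for \<kappa>
    proof -
      have j: "(\<Sum>p\<in>S. (x p)\<^sup>2) / 2 \<le> j" if "finite S" for S
        using half_sq_norm_le_iff[of j x] real that by auto
      have "- ereal (j + \<kappa>) \<le> ?l"
        by (rule liminf_log_prob_ge[OF speed open_set_bound[OF U x j \<kappa>]])
      then have "- ?l \<le> ereal (j + \<kappa>)"
        by (rule ereal_uminus_le_reorder[THEN iffD1])
      then show ?thesis
        unfolding plus_ereal.simps(1) .
    qed
    then have "- ?l \<le> ereal j"
      by (rule ereal_le_epsilon2[rule_format])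
    then show ?thesis
      unfolding real(2) enn2ereal_ennreal[OF real(1)] .
  qed simp
  have "- ?l \<le> enn2ereal (INF x\<in>U. half_sq_norm x)"
  proof (cases "- ?l \<ge> 0")
    case True
    have "e2ennreal (- ?l) \<le> (INF x\<in>U. half_sq_norm x)"
      by (intro INF_greatest) (simp only: less_eq_ennreal.rep_eq enn2ereal_e2ennreal[OF True] le)
    then show ?thesis
      by (simp only: less_eq_ennreal.rep_eq enn2ereal_e2ennreal[OF True])
  next
    case False
    then have "- ?l \<le> 0" using linear[of 0 "- ?l"] by blast
    then show ?thesis
      using enn2ereal_nonneg by (rule order_trans)
  qed
  then show "- enn2ereal (INF x\<in>U. half_sq_norm x) \<le> ?l"
    by (rule ereal_uminus_le_reorder[THEN iffD1])
qed

end

section \<open>Plane rotations and invariance of the Haar measure\<close>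

text \<open>Left multiplication by these matrices mixes the rows \<open>a\<close> and \<open>b\<close> only; they are the one-parameter
  groups whose generators span the Lie algebra of the orthogonal group.\<close>

definition plane_rotation :: "nat \<Rightarrow> nat \<Rightarrow> nat \<Rightarrow> real \<Rightarrow> real mat" where
  "plane_rotation N a b s = mat N N (\<lambda>(i, j).
     if i = a then cos s * of_bool (j = a) + sin s * of_bool (j = b)
     else if i = b then - sin s * of_bool (j = a) + cos s * of_bool (j = b)
     else of_bool (j = i))"

lemma plane_rotation_carrier [simp]: "plane_rotation N a b s \<in> carrier_mat N N"
  by (simp add: plane_rotation_def)

lemma plane_rotation_mult_index:
  assumes "A \<in> carrier_mat N m" "a < N" "b < N" "i < N" "j < m"
  shows "(plane_rotation N a b s * A) $$ (i, j) =
    (if i = a then cos s * A $$ (a, j) + sin s * A $$ (b, j)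
     else if i = b then - sin s * A $$ (a, j) + cos s * A $$ (b, j)
     else A $$ (i, j))"
proof -
  have "(plane_rotation N a b s * A) $$ (i, j)
      = (\<Sum>k\<in>{0..<N}. plane_rotation N a b s $$ (i, k) * A $$ (k, j))"
    using assms by (simp add: plane_rotation_def scalar_prod_def)
  also have "\<dots> = (\<Sum>k\<in>{0..<N}.
     (if i = a then (if k = a then cos s * A $$ (a, j) else 0) + (if k = b then sin s * A $$ (b, j) else 0)
     else if i = b then (if k = a then - sin s * A $$ (a, j) else 0) + (if k = b then cos s * A $$ (b, j) else 0)
     else (if k = i then A $$ (i, j) else 0)))"
    using assms by (intro sum.cong) (auto simp: plane_rotation_def algebra_simps)
  finally show ?thesis
    using assms by (auto simp: sum.distrib)
qed

lemma transpose_plane_rotation: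
  assumes "a \<noteq> b"
  shows "transpose_mat (plane_rotation N a b s) = plane_rotation N a b (- s)"
  using assms by (intro eq_matI) (auto simp: plane_rotation_def)

lemma plane_rotation_inverse:
  assumes ab: "a < N" "b < N" "a \<noteq> b"
  shows "plane_rotation N a b s * plane_rotation N a b (- s) = 1\<^sub>m N"
proof (rule eq_matI)
  fix i j assume ij: "i < dim_row (1\<^sub>m N :: real mat)" "j < dim_col (1\<^sub>m N :: real mat)"
  have sc: "sin s * sin s + cos s * cos s = 1" "cos s * cos s + sin s * sin s = 1"
    using sin_cos_squared_add[of s] by (auto simp: power2_eq_square)
  show "(plane_rotation N a b s * plane_rotation N a b (- s)) $$ (i, j) = 1\<^sub>m N $$ (i, j)"
    using ij ab
    by (subst plane_rotation_mult_index[where m = N]) (auto simp: plane_rotation_def sc)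
qed (auto simp: plane_rotation_def)

lemma plane_rotation_in_orthogonal_group:
  assumes "a < N" "b < N" "a \<noteq> b"
  shows "plane_rotation N a b s \<in> orthogonal_group N"
  using plane_rotation_inverse[OF assms, of s] plane_rotation_inverse[OF assms, of "- s"]
  by (simp add: orthogonal_group_def transpose_plane_rotation[OF assms(3)])

lemma orthogonal_group_mult:
  assumes "B \<in> orthogonal_group N" "A \<in> orthogonal_group N"
  shows "B * A \<in> orthogonal_group N"
proof -
  have c: "A \<in> carrier_mat N N" "B \<in> carrier_mat N N"
      "transpose_mat A \<in> carrier_mat N N" "transpose_mat B \<in> carrier_mat N N"
    and e: "A * transpose_mat A = 1\<^sub>m N" "transpose_mat A * A = 1\<^sub>m N"
      "B * transpose_mat B = 1\<^sub>m N" "transpose_mat B * B = 1\<^sub>m N"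
    using assms by (auto simp: orthogonal_group_def)
  have "B * A * (transpose_mat A * transpose_mat B) = B * (A * transpose_mat A) * transpose_mat B"
    using c by (simp add: assoc_mult_mat[of _ N N _ N _ N])
  moreover have "(transpose_mat A * transpose_mat B) * (B * A)
      = transpose_mat A * (transpose_mat B * B) * A"
    using c by (simp add: assoc_mult_mat[of _ N N _ N _ N])
  ultimately show ?thesis
    using c e by (simp add: orthogonal_group_def transpose_mult[of B N N A N])
qed

lemma transpose_in_orthogonal_group:
  "B \<in> orthogonal_group N \<Longrightarrow> transpose_mat B \<in> orthogonal_group N"
  by (auto simp: orthogonal_group_def)

lemma orthogonal_transpose_mult_cancel:
  assumes "B \<in> orthogonal_group N" "A \<in> orthogonal_group N"
  shows "transpose_mat B * (B * A) = A" "B * (transpose_mat B * A) = A"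
proof -
  have c: "A \<in> carrier_mat N N" "B \<in> carrier_mat N N" "transpose_mat B \<in> carrier_mat N N"
    and e: "B * transpose_mat B = 1\<^sub>m N" "transpose_mat B * B = 1\<^sub>m N"
    using assms by (auto simp: orthogonal_group_def)
  show "transpose_mat B * (B * A) = A" "B * (transpose_mat B * A) = A"
    using assoc_mult_mat[OF c(3,2,1)] assoc_mult_mat[OF c(2,3,1)] c e by simp_all
qed

lemma orthogonal_columns:
  assumes A: "A \<in> orthogonal_group N" and "j < N" "l < N"
  shows "(\<Sum>b<N. pad_mat A (b, j) * pad_mat A (b, l)) = of_bool (j = l)"
proof -
  have c: "A \<in> carrier_mat N N" and e: "transpose_mat A * A = 1\<^sub>m N"
    using A by (auto simp: orthogonal_group_def)
  have "(transpose_mat A * A) $$ (j, l) = (\<Sum>b<N. A $$ (b, j) * A $$ (b, l))"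
    using c assms by (simp add: scalar_prod_def lessThan_atLeast0)
  also have "\<dots> = (\<Sum>b<N. pad_mat A (b, j) * pad_mat A (b, l))"
    using c assms by (simp add: pad_mat_def)
  finally have "(\<Sum>b<N. pad_mat A (b, j) * pad_mat A (b, l)) = 1\<^sub>m N $$ (j, l)"
    unfolding e by (rule sym)
  then show ?thesis
    using assms by simp
qed

lemma abs_pad_mat_le_1:
  assumes A: "A \<in> orthogonal_group N"
  shows "\<bar>pad_mat A p\<bar> \<le> 1"
proof (cases "fst p < N \<and> snd p < N")
  case True
  have "(pad_mat A p)\<^sup>2 \<le> (\<Sum>b<N. (pad_mat A (b, snd p))\<^sup>2)"
    using True member_le_sum[of "fst p" "{..<N}" "\<lambda>b. (pad_mat A (b, snd p))\<^sup>2"] by simp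
  also have "\<dots> = 1"
    using orthogonal_columns[OF A, of "snd p" "snd p"] True by (simp add: power2_eq_square)
  finally show ?thesis
    by (simp add: abs_square_le_1)
next
  case False
  then show ?thesis
    using A by (auto simp: pad_mat_def orthogonal_group_def split: prod.splits)
qed

lemma pad_mat_rotation:
  assumes "A \<in> carrier_mat N N" "a < N" "b < N"
  shows "pad_mat (plane_rotation N a b s * A) (i, j) =
    (if i = a then cos s * pad_mat A (a, j) + sin s * pad_mat A (b, j)
     else if i = b then - sin s * pad_mat A (a, j) + cos s * pad_mat A (b, j)
     else pad_mat A (i, j))"
proof -
  have [simp]: "dim_row (plane_rotation N a b s) = N"
    by (simp add: plane_rotation_def)
  show ?thesis
    using assms plane_rotation_mult_index[OF assms, of i j s]
    by (cases "i < N \<and> j < N") (auto simp: pad_mat_def simp del: index_mult_mat(1))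
qed

locale haar_measure = prob_space \<mu> for \<mu> :: "real mat measure" +
  fixes N :: nat
  assumes haar: "haar_orthogonal N \<mu>"

lemma haar_measureI:
  assumes "haar_orthogonal N \<mu>"
  shows "haar_measure \<mu> N"
  using assms by (simp add: haar_measure_def haar_measure_axioms_def haar_orthogonal_def)

context haar_measure
begin

lemma sets_haar [measurable_cong]: "sets \<mu> = sets (borel_orthogonal N)"
  using haar by (simp add: haar_orthogonal_def)

lemma space_haar: "space \<mu> = orthogonal_group N"
  using sets_eq_imp_space_eq[OF sets_haar] by (simp add: borel_orthogonal_def)

lemma pad_mat_measurable: "pad_mat \<in> borel_measurable \<mu>"
  by (subst measurable_cong_sets[OF sets_haar refl])
    (simp add: borel_orthogonal_def measurable_vimage_algebra1)

lemma entry_measurable [measurable]: "(\<lambda>A. pad_mat A p) \<in> borel_measurable \<mu>"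
  using measurable_product_then_coordinatewise[OF pad_mat_measurable, of p] .

lemma left_mult_measurable:
  assumes B: "B \<in> orthogonal_group N"
  shows "(\<lambda>A. B * A) \<in> \<mu> \<rightarrow>\<^sub>M \<mu>"
proof -
  have "(\<lambda>A. B * A) \<in> \<mu> \<rightarrow>\<^sub>M borel_orthogonal N"
    unfolding borel_orthogonal_def
  proof (rule measurable_vimage_algebra2)
    show "(\<lambda>A. B * A) \<in> space \<mu> \<rightarrow> orthogonal_group N"
      using orthogonal_group_mult[OF B] by (auto simp: space_haar)
    show "(\<lambda>A. pad_mat (B * A)) \<in> borel_measurable \<mu>"
    proof (rule measurable_coordinatewise_then_product)
      fix p :: "nat \<times> nat"
      obtain i j where p: "p = (i, j)" by fastforce
      have "(\<lambda>A. if i < N \<and> j < N then \<Sum>k<N. B $$ (i, k) * pad_mat A (k, j) else 0)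
          \<in> borel_measurable \<mu>"
        by measurable
      also have "?this \<longleftrightarrow> (\<lambda>A. pad_mat (B * A) p) \<in> borel_measurable \<mu>"
      proof (rule measurable_cong)
        fix A assume "A \<in> space \<mu>"
        then have c: "A \<in> carrier_mat N N" "B \<in> carrier_mat N N"
          using B by (auto simp: space_haar orthogonal_group_def)
        then show "(if i < N \<and> j < N then \<Sum>k<N. B $$ (i, k) * pad_mat A (k, j) else 0)
            = pad_mat (B * A) p"
          by (auto simp: p pad_mat_def scalar_prod_def lessThan_atLeast0)
      qed
      finally show "(\<lambda>A. pad_mat (B * A) p) \<in> borel_measurable \<mu>" .
    qed
  qed
  then show ?thesis
    by (subst measurable_cong_sets[OF refl sets_haar])
qed

text \<open>Invariance is defined through images of sets; the preimage of a set under \<open>B\<close> is its image under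
  the transpose of \<open>B\<close>.\<close>

lemma distr_left_mult:
  assumes B: "B \<in> orthogonal_group N"
  shows "distr \<mu> \<mu> (\<lambda>A. B * A) = \<mu>"
proof (rule measure_eqI)
  fix S assume "S \<in> sets (distr \<mu> \<mu> (\<lambda>A. B * A))"
  then have S: "S \<in> sets \<mu>" by simp
  then have sub: "S \<subseteq> orthogonal_group N"
    using sets.sets_into_space space_haar by blast
  have "(\<lambda>A. B * A) -` S \<inter> space \<mu> = (\<lambda>A. transpose_mat B * A) ` S"
  proof (intro equalityI subsetI)
    fix A assume "A \<in> (\<lambda>A. B * A) -` S \<inter> space \<mu>"
    then show "A \<in> (\<lambda>A. transpose_mat B * A) ` S"
      using orthogonal_transpose_mult_cancel(1)[OF B, of A]
      by (auto simp: space_haar intro!: image_eqI[where x = "B * A"])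
  next
    fix A assume "A \<in> (\<lambda>A. transpose_mat B * A) ` S"
    then show "A \<in> (\<lambda>A. B * A) -` S \<inter> space \<mu>"
      using orthogonal_transpose_mult_cancel(2)[OF B] sub
        orthogonal_group_mult[OF transpose_in_orthogonal_group[OF B]]
      by (auto simp: space_haar subset_iff)
  qed
  then show "emeasure (distr \<mu> \<mu> (\<lambda>A. B * A)) S = emeasure \<mu> S"
    using haar transpose_in_orthogonal_group[OF B] S
    by (simp add: emeasure_distr[OF left_mult_measurable[OF B]] haar_orthogonal_def)
qed simp

lemma integral_left_mult:
  fixes f :: "real mat \<Rightarrow> real"
  assumes "B \<in> orthogonal_group N" and [measurable]: "f \<in> borel_measurable \<mu>"
  shows "(\<integral>A. f (B * A) \<partial>\<mu>) = (\<integral>A. f A \<partial>\<mu>)"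
  using integral_distr[OF left_mult_measurable[OF assms(1)], of f] distr_left_mult[OF assms(1)]
  by simp

lemma integrable_bounded:
  fixes f :: "real mat \<Rightarrow> real"
  assumes "f \<in> borel_measurable \<mu>" "\<And>A. A \<in> space \<mu> \<Longrightarrow> \<bar>f A\<bar> \<le> K"
  shows "integrable \<mu> f"
  using assms by (intro integrable_const_bound[where B = K]) auto

lemma abs_entry_le_1: "A \<in> space \<mu> \<Longrightarrow> \<bar>pad_mat A p\<bar> \<le> 1"
  using abs_pad_mat_le_1 by (simp add: space_haar)

end

text \<open>A linear form in the entries of a Haar distributed matrix \<open>A\<close>. Its coefficients form a matrix
  \<open>\<theta>\<close>; then \<open>pairing a b A\<close> is the entry \<open>(a, b)\<close> of \<open>\<theta> * transpose A\<close>, while \<open>form A\<close> is the trace of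
  \<open>\<theta> * transpose A\<close> and \<open>remainder A\<close> is the trace of its square. Entries are taken from the padded matrix,
  which makes every function below measurable without side conditions on the indices.\<close>

locale haar_linear_form = haar_measure +
  fixes \<theta> :: "nat \<times> nat \<Rightarrow> real"
begin

definition pairing :: "nat \<Rightarrow> nat \<Rightarrow> real mat \<Rightarrow> real" where
  "pairing a b A = (\<Sum>j<N. \<theta> (a, j) * pad_mat A (b, j))"

definition form :: "real mat \<Rightarrow> real" where
  "form A = (\<Sum>a<N. pairing a a A)"

definition "norm1 = (\<Sum>a<N. \<Sum>j<N. \<bar>\<theta> (a, j)\<bar>)"

definition "normsq = (\<Sum>a<N. \<Sum>j<N. (\<theta> (a, j))\<^sup>2)"

definition remainder :: "real mat \<Rightarrow> real" where
  "remainder A = (\<Sum>a<N. \<Sum>b<N. pairing a b A * pairing b a A)"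

definition mgf :: "real \<Rightarrow> real" where
  "mgf t = (\<integral>A. exp (t * form A) \<partial>\<mu>)"

lemma pairing_measurable [measurable]: "pairing a b \<in> borel_measurable \<mu>"
  unfolding pairing_def by measurable

lemma form_measurable [measurable]: "form \<in> borel_measurable \<mu>"
  unfolding form_def by measurable

lemma remainder_measurable [measurable]: "remainder \<in> borel_measurable \<mu>"
  unfolding remainder_def by measurable

lemma abs_pairing_le_row:
  assumes "A \<in> space \<mu>"
  shows "\<bar>pairing a b A\<bar> \<le> (\<Sum>j<N. \<bar>\<theta> (a, j)\<bar>)"
proof -
  have "\<bar>pairing a b A\<bar> \<le> (\<Sum>j<N. \<bar>\<theta> (a, j) * pad_mat A (b, j)\<bar>)"
    unfolding pairing_def by (rule sum_abs)
  also have "\<dots> \<le> (\<Sum>j<N. \<bar>\<theta> (a, j)\<bar> * 1)"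
    unfolding abs_mult by (intro sum_mono mult_left_mono abs_entry_le_1 assms) auto
  finally show ?thesis by simp
qed

lemma abs_pairing_le:
  assumes "A \<in> space \<mu>" "a < N"
  shows "\<bar>pairing a b A\<bar> \<le> norm1"
  using abs_pairing_le_row[OF assms(1), of a b] assms(2)
    member_le_sum[of a "{..<N}" "\<lambda>a. \<Sum>j<N. \<bar>\<theta> (a, j)\<bar>"]
  by (auto simp: norm1_def sum_nonneg)

lemma abs_form_le:
  assumes "A \<in> space \<mu>"
  shows "\<bar>form A\<bar> \<le> norm1"
  unfolding form_def norm1_def
  by (rule order_trans[OF sum_abs sum_mono]) (rule abs_pairing_le_row[OF assms])

lemma norm1_nonneg: "norm1 \<ge> 0"
  by (simp add: norm1_def sum_nonneg)

lemma abs_t_form_le: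
  assumes "A \<in> space \<mu>"
  shows "t * form A \<le> \<bar>t\<bar> * norm1" "- (\<bar>t\<bar> * norm1) \<le> t * form A"
proof -
  have "\<bar>t * form A\<bar> \<le> \<bar>t\<bar> * norm1"
    unfolding abs_mult by (intro mult_left_mono abs_form_le assms) auto
  then show "t * form A \<le> \<bar>t\<bar> * norm1" "- (\<bar>t\<bar> * norm1) \<le> t * form A"
    by linarith+
qed

lemma integrable_bounded_times_exp:
  assumes [measurable]: "f \<in> borel_measurable \<mu>" and "\<And>A. A \<in> space \<mu> \<Longrightarrow> \<bar>f A\<bar> \<le> K"
  shows "integrable \<mu> (\<lambda>A. f A * exp (t * form A))"
proof (rule integrable_bounded[where K = "K * exp (\<bar>t\<bar> * norm1)"])
  fix A assume A: "A \<in> space \<mu>"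
  then have "0 \<le> K" using assms(2)[OF A] by linarith
  then show "\<bar>f A * exp (t * form A)\<bar> \<le> K * exp (\<bar>t\<bar> * norm1)"
    unfolding abs_mult using assms(2)[OF A] abs_t_form_le[OF A]
    by (intro mult_mono) auto
qed measurable

lemma pairing_rotation:
  assumes "A \<in> space \<mu>" "a < N" "b < N"
  shows "pairing i l (plane_rotation N a b s * A) =
    (if l = a then cos s * pairing i a A + sin s * pairing i b A
     else if l = b then - sin s * pairing i a A + cos s * pairing i b A
     else pairing i l A)"
  using assms pad_mat_rotation[of A N a b s l]
  by (auto simp: pairing_def space_haar orthogonal_group_def sum.distrib sum_distrib_left
      sum_subtractf sum_negf algebra_simps)

lemma form_split:
  assumes "a < N" "b < N" "a \<noteq> b"
  shows "form A = pairing a a A + pairing b b A + (\<Sum>i\<in>{..<N} - {a, b}. pairing i i A)"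
proof -
  have "form A = (\<Sum>i\<in>{a, b}. pairing i i A) + (\<Sum>i\<in>{..<N} - {a, b}. pairing i i A)"
    unfolding form_def using assms by (subst sum.subset_diff[of "{a, b}"]) auto
  then show ?thesis using assms by simp
qed

lemma form_rotation:
  assumes "A \<in> space \<mu>" "a < N" "b < N" "a \<noteq> b"
  shows "form (plane_rotation N a b s * A) = (form A - pairing a a A - pairing b b A)
    + cos s * pairing a a A + sin s * pairing a b A
    - sin s * pairing b a A + cos s * pairing b b A"
proof -
  have "(\<Sum>i\<in>{..<N} - {a, b}. pairing i i (plane_rotation N a b s * A))
      = (\<Sum>i\<in>{..<N} - {a, b}. pairing i i A)"
    using pairing_rotation[OF assms(1-3)] by (intro sum.cong) auto
  then show ?thesis
    using assms pairing_rotation[OF assms(1-3)]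
    by (simp add: form_split[OF assms(2-4)])
qed

end

section \<open>The Laplace transform of a linear form\<close>

context haar_linear_form
begin

text \<open>By invariance, the integral of \<open>pairing a b * exp (t * form)\<close>, evaluated at the matrix whose rows
  \<open>a\<close> and \<open>b\<close> are rotated by the angle \<open>s\<close>, does not depend on \<open>s\<close>. The claim is the vanishing of its
  derivative at \<open>s = 0\<close>.\<close>

lemma rotation_identity:
  assumes ab: "a < N" "b < N" "a \<noteq> b"
  shows "(\<integral>A. (- pairing a a A + t * pairing a b A * (pairing a b A - pairing b a A))
      * exp (t * form A) \<partial>\<mu>) = 0"
proof -
  define E where "E = (\<lambda>s A. exp (t * ((form A - pairing a a A - pairing b b A)
    + cos s * pairing a a A + sin s * pairing a b A
    - sin s * pairing b a A + cos s * pairing b b A)))"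
  define f where "f = (\<lambda>s A. (- sin s * pairing a a A + cos s * pairing a b A) * E s A)"
  define f' where "f' = (\<lambda>s A.
      (- cos s * pairing a a A - sin s * pairing a b A
       + (- sin s * pairing a a A + cos s * pairing a b A) *
         (t * (- sin s * pairing a a A + cos s * pairing a b A
               - cos s * pairing b a A - sin s * pairing b b A))) * E s A)"
  have [measurable]: "E s \<in> borel_measurable \<mu>" for s
    unfolding E_def by measurable
  have f_eq: "f s A = pairing a b (plane_rotation N a b s * A) *
      exp (t * form (plane_rotation N a b s * A))" if "A \<in> space \<mu>" for s A
    using ab by (simp add: f_def E_def pairing_rotation[OF that] form_rotation[OF that])
  have const: "(\<integral>A. f s A \<partial>\<mu>) = (\<integral>A. pairing a b A * exp (t * form A) \<partial>\<mu>)" for s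
  proof -
    have "(\<integral>A. f s A \<partial>\<mu>) = (\<integral>A. pairing a b (plane_rotation N a b s * A) *
      exp (t * form (plane_rotation N a b s * A)) \<partial>\<mu>)"
      by (intro Bochner_Integration.integral_cong refl f_eq)
    also have "\<dots> = (\<integral>A. pairing a b A * exp (t * form A) \<partial>\<mu>)"
      by (rule integral_left_mult[OF plane_rotation_in_orthogonal_group[OF ab]]) measurable
    finally show ?thesis .
  qed
  have sc: "\<bar>sin s * x\<bar> \<le> norm1" "\<bar>cos s * x\<bar> \<le> norm1" if "\<bar>x\<bar> \<le> norm1" for s x :: real
    using mult_mono[OF abs_sin_le_one[of s] that] mult_mono[OF abs_cos_le_one[of s] that]
    by (auto simp: abs_mult)
  have bounds: "\<bar>E s A\<bar> \<le> exp (\<bar>t\<bar> * (7 * norm1))"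
      "\<bar>- sin s * pairing a a A + cos s * pairing a b A\<bar> \<le> 2 * norm1"
      "\<bar>- cos s * pairing a a A - sin s * pairing a b A\<bar> \<le> 2 * norm1"
      "\<bar>- sin s * pairing a a A + cos s * pairing a b A
               - cos s * pairing b a A - sin s * pairing b b A\<bar> \<le> 4 * norm1"
    if A: "A \<in> space \<mu>" for s A
  proof -
    note le = abs_form_le[OF A] abs_pairing_le[OF A ab(1), of a] abs_pairing_le[OF A ab(1), of b]
      abs_pairing_le[OF A ab(2), of a] abs_pairing_le[OF A ab(2), of b]
    note le' = le[THEN abs_le_D1] le[THEN abs_le_D2]
    note sc' = sc[OF le(2), of s] sc[OF le(3), of s] sc[OF le(4), of s] sc[OF le(5), of s]
    note sc'' = sc'[THEN abs_le_D1] sc'[THEN abs_le_D2]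
    have "\<bar>(form A - pairing a a A - pairing b b A)
      + cos s * pairing a a A + sin s * pairing a b A
      - sin s * pairing b a A + cos s * pairing b b A\<bar> \<le> 7 * norm1" (is "\<bar>?x\<bar> \<le> _")
      by (rule abs_leI) (use le' sc'' in linarith)+
    then have "\<bar>t * ?x\<bar> \<le> \<bar>t\<bar> * (7 * norm1)"
      unfolding abs_mult by (intro mult_left_mono) auto
    then show "\<bar>E s A\<bar> \<le> exp (\<bar>t\<bar> * (7 * norm1))"
      unfolding E_def abs_exp_cancel exp_le_cancel_iff by linarith
    show "\<bar>- sin s * pairing a a A + cos s * pairing a b A\<bar> \<le> 2 * norm1"
      "\<bar>- cos s * pairing a a A - sin s * pairing a b A\<bar> \<le> 2 * norm1"
      "\<bar>- sin s * pairing a a A + cos s * pairing a b A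
               - cos s * pairing b a A - sin s * pairing b b A\<bar> \<le> 4 * norm1"
      unfolding mult_minus_left by ((rule abs_leI); use sc'' in linarith)+
  qed
  have "((\<lambda>s. \<integral>A. f s A \<partial>\<mu>) has_real_derivative (\<integral>A. f' 0 A \<partial>\<mu>)) (at 0)"
  proof (rule has_derivative_integral_bounded)
    show "finite_measure \<mu>" by (rule finite_measure_axioms)
    show "integrable \<mu> (f s)" for s
    proof (rule integrable_bounded)
      show "f s \<in> borel_measurable \<mu>" unfolding f_def by measurable
      show "\<bar>f s A\<bar> \<le> 2 * norm1 * exp (\<bar>t\<bar> * (7 * norm1))" if "A \<in> space \<mu>" for A
        unfolding f_def abs_mult[of _ "E s A"] using bounds[OF that, of s] norm1_nonneg
        by (intro mult_mono) auto
    qed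
    show "f' 0 \<in> borel_measurable \<mu>" unfolding f'_def by measurable
    show "((\<lambda>s. f s A) has_real_derivative f' s A) (at s)" for s A
      unfolding f_def f'_def E_def
      by (auto intro!: derivative_eq_intros) (simp add: algebra_simps)
    show "\<bar>f' s A\<bar> \<le> (2 * norm1 + 2 * norm1 * (\<bar>t\<bar> * (4 * norm1))) * exp (\<bar>t\<bar> * (7 * norm1))"
      if A: "A \<in> space \<mu>" for s A
      unfolding f'_def abs_mult[of _ "E s A"]
    proof (intro mult_mono order_trans[OF abs_triangle_ineq] add_mono)
      show "\<bar>(- sin s * pairing a a A + cos s * pairing a b A) *
         (t * (- sin s * pairing a a A + cos s * pairing a b A
               - cos s * pairing b a A - sin s * pairing b b A))\<bar>
        \<le> 2 * norm1 * (\<bar>t\<bar> * (4 * norm1))"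
        unfolding abs_mult[of "- sin s * pairing a a A + cos s * pairing a b A"] abs_mult[of t]
        using bounds[OF A, of s] norm1_nonneg by (intro mult_mono) auto
    qed (use bounds[OF A, of s] norm1_nonneg in auto)
  qed
  then have "(\<integral>A. f' 0 A \<partial>\<mu>) = 0"
    unfolding const by (rule DERIV_unique) simp
  moreover have "f' 0 = (\<lambda>A. (- pairing a a A + t * pairing a b A * (pairing a b A - pairing b a A))
      * exp (t * form A))"
    by (simp add: f'_def E_def algebra_simps)
  ultimately show ?thesis by simp
qed

text \<open>Multiplication by an orthogonal matrix preserves the norm of the row \<open>a\<close> of the coefficients.\<close>

lemma sum_pairing_sq:
  assumes "A \<in> space \<mu>"
  shows "(\<Sum>b<N. (pairing a b A)\<^sup>2) = (\<Sum>j<N. (\<theta> (a, j))\<^sup>2)"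
proof -
  have "(\<Sum>b<N. (pairing a b A)\<^sup>2)
      = (\<Sum>b<N. \<Sum>j<N. \<Sum>l<N. \<theta> (a, j) * \<theta> (a, l) * (pad_mat A (b, j) * pad_mat A (b, l)))"
    by (simp add: pairing_def power2_eq_square sum_product algebra_simps)
  also have "\<dots> = (\<Sum>j<N. \<Sum>l<N. \<Sum>b<N. \<theta> (a, j) * \<theta> (a, l) * (pad_mat A (b, j) * pad_mat A (b, l)))"
    by (subst sum.swap, rule sum.cong[OF refl], rule sum.swap)
  also have "\<dots> = (\<Sum>j<N. \<Sum>l<N. \<theta> (a, j) * \<theta> (a, l) * of_bool (j = l))"
    using orthogonal_columns assms by (simp add: space_haar flip: sum_distrib_left)
  also have "\<dots> = (\<Sum>j<N. \<Sum>l<N. if j = l then (\<theta> (a, j))\<^sup>2 else 0)"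
    by (intro sum.cong refl) (auto simp: power2_eq_square)
  finally show ?thesis by simp
qed

lemma abs_remainder_le:
  assumes "A \<in> space \<mu>"
  shows "\<bar>remainder A\<bar> \<le> real N * (real N * (norm1 * norm1))"
proof -
  have "\<bar>remainder A\<bar> \<le> (\<Sum>a<N. \<Sum>b<N. \<bar>pairing a b A * pairing b a A\<bar>)"
    unfolding remainder_def by (rule order_trans[OF sum_abs sum_mono[OF sum_abs]])
  also have "\<dots> \<le> (\<Sum>a<N. \<Sum>b<N. norm1 * norm1)"
    unfolding abs_mult using abs_pairing_le[OF assms] norm1_nonneg
    by (intro sum_mono mult_mono) auto
  finally show ?thesis by simp
qed

lemma integrable_form_exp: "integrable \<mu> (\<lambda>A. form A * exp (t * form A))"
  by (rule integrable_bounded_times_exp[OF _ abs_form_le]) measurable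

lemma integrable_remainder_exp: "integrable \<mu> (\<lambda>A. remainder A * exp (t * form A))"
  by (rule integrable_bounded_times_exp[OF _ abs_remainder_le]) measurable

lemma integrable_exp: "integrable \<mu> (\<lambda>A. exp (t * form A))"
  using integrable_bounded_times_exp[of "\<lambda>_. 1" 1 t] by simp

text \<open>Summing the rotation identities over all ordered pairs of distinct rows gives a relation between the
  derivative of the Laplace transform and the transform itself. Without the remainder it would be
  the differential equation of a centred Gaussian with variance \<open>normsq / (N - 1)\<close>.\<close>

lemma mgf_rotation_identity:
  assumes N: "N \<ge> 1"
  shows "(real N - 1) * (\<integral>A. form A * exp (t * form A) \<partial>\<mu>)
    = t * (normsq * mgf t - (\<integral>A. remainder A * exp (t * form A) \<partial>\<mu>))"
proof -
  define g where "g = (\<lambda>a b A. - pairing a a A + t * pairing a b A * (pairing a b A - pairing b a A))"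
  have int: "integrable \<mu> (\<lambda>A. g a b A * exp (t * form A))" if "a < N" "b < N" for a b
  proof (rule integrable_bounded_times_exp)
    show "g a b \<in> borel_measurable \<mu>" unfolding g_def by measurable
    fix A assume A: "A \<in> space \<mu>"
    have "\<bar>pairing a b A - pairing b a A\<bar> \<le> 2 * norm1"
      using abs_pairing_le[OF A that(1), of b] abs_pairing_le[OF A that(2), of a] by linarith
    then have "\<bar>t * pairing a b A * (pairing a b A - pairing b a A)\<bar> \<le> \<bar>t\<bar> * norm1 * (2 * norm1)"
      unfolding abs_mult using abs_pairing_le[OF A that(1), of b] norm1_nonneg
      by (intro mult_mono) auto
    then show "\<bar>g a b A\<bar> \<le> norm1 + \<bar>t\<bar> * norm1 * (2 * norm1)"
      unfolding g_def using abs_pairing_le[OF A that(1), of a] by linarith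
  qed
  \<comment> \<open>The diagonal term \<open>b = a\<close> may be added to the two quadratic sums, where it cancels.\<close>
  have row: "(\<Sum>b\<in>{..<N} - {a}. g a b A) = - (real N - 1) * pairing a a A
      + t * ((\<Sum>j<N. (\<theta> (a, j))\<^sup>2) - (\<Sum>b<N. pairing a b A * pairing b a A))"
    if "a < N" "A \<in> space \<mu>" for a A
  proof -
    have "(\<Sum>b\<in>{..<N} - {a}. g a b A) = (\<Sum>b<N. g a b A) - g a a A"
      using that(1) by (simp add: sum_diff1)
    also have "(\<Sum>b<N. g a b A) = - real N * pairing a a A
        + t * ((\<Sum>b<N. (pairing a b A)\<^sup>2) - (\<Sum>b<N. pairing a b A * pairing b a A))"
      by (simp add: g_def sum.distrib power2_eq_square algebra_simps sum_distrib_left sum_subtractf sum_negf)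
    finally show ?thesis
      using sum_pairing_sq[OF that(2), of a] by (simp add: g_def algebra_simps)
  qed
  have "0 = (\<Sum>a<N. \<Sum>b\<in>{..<N} - {a}. \<integral>A. g a b A * exp (t * form A) \<partial>\<mu>)"
    using rotation_identity[of _ _ t] by (auto simp: g_def intro!: sum.neutral[symmetric])
  also have "\<dots> = (\<integral>A. (\<Sum>a<N. \<Sum>b\<in>{..<N} - {a}. g a b A * exp (t * form A)) \<partial>\<mu>)"
    by (subst Bochner_Integration.integral_sum, use int in force)
      (intro sum.cong refl Bochner_Integration.integral_sum[symmetric], use int in auto)
  also have "\<dots> = (\<integral>A. - (real N - 1) * (form A * exp (t * form A))
      + t * (normsq * exp (t * form A) - remainder A * exp (t * form A)) \<partial>\<mu>)"
  proof (rule Bochner_Integration.integral_cong[OF refl])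
    fix A assume A: "A \<in> space \<mu>"
    have "(\<Sum>a<N. \<Sum>b\<in>{..<N} - {a}. g a b A * exp (t * form A))
        = (\<Sum>a<N. \<Sum>b\<in>{..<N} - {a}. g a b A) * exp (t * form A)"
      by (simp add: sum_distrib_right)
    also have "(\<Sum>a<N. \<Sum>b\<in>{..<N} - {a}. g a b A) = (\<Sum>a<N. - (real N - 1) * pairing a a A
        + t * ((\<Sum>j<N. (\<theta> (a, j))\<^sup>2) - (\<Sum>b<N. pairing a b A * pairing b a A)))"
      by (intro sum.cong refl row A) simp
    also have "\<dots> = - (real N - 1) * form A + t * (normsq - remainder A)"
      unfolding form_def normsq_def remainder_def sum.distrib sum_distrib_left[symmetric]
        sum_subtractf ..
    finally show "(\<Sum>a<N. \<Sum>b\<in>{..<N} - {a}. g a b A * exp (t * form A))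
      = - (real N - 1) * (form A * exp (t * form A))
      + t * (normsq * exp (t * form A) - remainder A * exp (t * form A))"
      by (simp add: algebra_simps)
  qed
  also have "\<dots> = - (real N - 1) * (\<integral>A. form A * exp (t * form A) \<partial>\<mu>)
      + t * (normsq * mgf t - (\<integral>A. remainder A * exp (t * form A) \<partial>\<mu>))"
    using integrable_form_exp[of t] integrable_remainder_exp[of t] integrable_exp[of t]
    by (simp add: mgf_def)
  finally show ?thesis by (simp add: algebra_simps)
qed

lemma mgf_has_derivative:
  "(mgf has_real_derivative (\<integral>A. form A * exp (t * form A) \<partial>\<mu>)) (at t)"
  unfolding mgf_def
proof (rule has_derivative_integral_bounded)
  show "finite_measure \<mu>" by (rule finite_measure_axioms)
  show "((\<lambda>s. exp (s * form A)) has_real_derivative form A * exp (s * form A)) (at s)" for s A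
    by (auto intro!: derivative_eq_intros)
  show "\<bar>form A * exp (s * form A)\<bar> \<le> norm1 * exp ((\<bar>t\<bar> + 1) * norm1)"
    if "\<bar>s - t\<bar> < 1" "A \<in> space \<mu>" for s A
  proof -
    have "s * form A \<le> (\<bar>t\<bar> + 1) * norm1"
      using abs_t_form_le(1)[OF that(2), of s]
        mult_right_mono[OF _ norm1_nonneg, of "\<bar>s\<bar>" "\<bar>t\<bar> + 1"] that(1) by linarith
    then show ?thesis
      unfolding abs_mult using abs_form_le[OF that(2)] norm1_nonneg by (intro mult_mono) auto
  qed
  show "(\<lambda>A. form A * exp (t * form A)) \<in> borel_measurable \<mu>" by measurable
qed (rule integrable_exp)

lemma mgf_0: "mgf 0 = 1"
  by (simp add: mgf_def prob_space)

lemma mgf_ge: "mgf t \<ge> exp (- (\<bar>t\<bar> * norm1))"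
proof -
  have "(\<integral>A. exp (- (\<bar>t\<bar> * norm1)) \<partial>\<mu>) \<le> mgf t"
    unfolding mgf_def by (intro integral_mono integrable_exp) (auto simp: abs_t_form_le)
  then show ?thesis by (simp add: prob_space)
qed

text \<open>A bound for the weighted remainder relative to the Laplace transform turns the relation
  above into a differential inequality.\<close>

lemma mgf_upper_bound:
  assumes N: "N \<ge> 2" and T: "T \<ge> 0"
    and R: "\<And>t. 0 \<le> t \<Longrightarrow> t \<le> T \<Longrightarrow> - \<delta> * mgf t \<le> (\<integral>A. remainder A * exp (t * form A) \<partial>\<mu>)"
  shows "mgf T \<le> exp ((normsq + \<delta>) * T\<^sup>2 / (2 * (real N - 1)))"
proof -
  have "mgf T \<le> mgf 0 * exp ((normsq + \<delta>) / (real N - 1) * T\<^sup>2 / 2)"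
  proof (rule gaussian_gronwall_upper[OF mgf_has_derivative _ T])
    fix t assume t: "0 \<le> t" "t \<le> T"
    have "(real N - 1) * (\<integral>A. form A * exp (t * form A) \<partial>\<mu>) \<le> t * ((normsq + \<delta>) * mgf t)"
    proof -
      have "normsq * mgf t - (\<integral>A. remainder A * exp (t * form A) \<partial>\<mu>) \<le> (normsq + \<delta>) * mgf t"
        using R[OF t] by (simp add: algebra_simps)
      then show ?thesis
        using N t by (subst mgf_rotation_identity) (auto intro: mult_left_mono)
    qed
    then show "(\<integral>A. form A * exp (t * form A) \<partial>\<mu>) \<le> (normsq + \<delta>) / (real N - 1) * t * mgf t"
      using N by (simp add: field_simps)
  qed
  then show ?thesis by (simp add: mgf_0 mult.commute)
qed

lemma mgf_lower_bound:
  assumes N: "N \<ge> 2" and T: "T \<ge> 0"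
    and R: "\<And>t. 0 \<le> t \<Longrightarrow> t \<le> T \<Longrightarrow> (\<integral>A. remainder A * exp (t * form A) \<partial>\<mu>) \<le> \<delta> * mgf t"
  shows "exp ((normsq - \<delta>) * T\<^sup>2 / (2 * (real N - 1))) \<le> mgf T"
proof -
  have "mgf 0 * exp ((normsq - \<delta>) / (real N - 1) * T\<^sup>2 / 2) \<le> mgf T"
  proof (rule gaussian_gronwall_lower[OF mgf_has_derivative _ T])
    fix t assume t: "0 \<le> t" "t \<le> T"
    have "t * ((normsq - \<delta>) * mgf t) \<le> (real N - 1) * (\<integral>A. form A * exp (t * form A) \<partial>\<mu>)"
    proof -
      have "(normsq - \<delta>) * mgf t \<le> normsq * mgf t - (\<integral>A. remainder A * exp (t * form A) \<partial>\<mu>)"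
        using R[OF t] by (simp add: algebra_simps)
      then show ?thesis
        using N t by (subst mgf_rotation_identity) (auto intro: mult_left_mono)
    qed
    then show "(normsq - \<delta>) / (real N - 1) * t * mgf t \<le> (\<integral>A. form A * exp (t * form A) \<partial>\<mu>)"
      using N by (simp add: field_simps)
  qed
  then show ?thesis by (simp add: mgf_0 mult.commute)
qed

end

context haar_measure
begin

text \<open>For a single entry the remainder is a nonnegative multiple of the square of that entry, and the Gaussian
  upper bound holds without any error term.\<close>

lemma entry_exp_moment:
  assumes N: "N \<ge> 2"
  shows "(\<integral>A. exp (c * pad_mat A p) \<partial>\<mu>) \<le> exp (c\<^sup>2 / (2 * (real N - 1)))"
proof (cases "fst p < N \<and> snd p < N")
  case True
  obtain i j where p: "p = (i, j)" by fastforce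
  with True have ij: "i < N" "j < N" by auto
  interpret haar_linear_form \<mu> N "\<lambda>q. if q = p then c else 0" ..
  have pair: "pairing a b A = (if a = i then c * pad_mat A (b, j) else 0)" for a b A
  proof -
    have "pairing a b A = (\<Sum>l<N. if l = j then (if a = i then c * pad_mat A (b, j) else 0) else 0)"
      unfolding pairing_def by (intro sum.cong) (auto simp: p)
    then show ?thesis using ij by simp
  qed
  have form: "form A = c * pad_mat A p" for A
    unfolding form_def pair using ij by (simp add: p)
  have normsq: "normsq = c\<^sup>2"
  proof -
    have "normsq = (\<Sum>a<N. \<Sum>l<N. if l = j then (if a = i then c\<^sup>2 else 0) else 0)"
      unfolding normsq_def by (intro sum.cong) (auto simp: p)
    then show ?thesis using ij by simp
  qed
  have "remainder A \<ge> 0" for A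
    unfolding remainder_def pair by (intro sum_nonneg) auto
  then have "mgf 1 \<le> exp ((normsq + 0) * 1\<^sup>2 / (2 * (real N - 1)))"
    using N by (intro mgf_upper_bound) (auto intro!: integral_nonneg)
  then show ?thesis
    by (simp add: mgf_def form normsq)
next
  case False
  have "(\<integral>A. exp (c * pad_mat A p) \<partial>\<mu>) = (\<integral>A. 1 \<partial>\<mu>)"
    using False
    by (intro Bochner_Integration.integral_cong)
      (auto simp: space_haar orthogonal_group_def pad_mat_def split: prod.splits)
  then show ?thesis
    using N by (simp add: prob_space)
qed

lemma integrable_entry_exp: "integrable \<mu> (\<lambda>A. exp (c * pad_mat A p))"
proof (rule integrable_bounded[where K = "exp \<bar>c\<bar>"])
  fix A assume "A \<in> space \<mu>"
  then have "\<bar>c * pad_mat A p\<bar> \<le> \<bar>c\<bar> * 1"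
    unfolding abs_mult by (intro mult_left_mono abs_entry_le_1) auto
  then show "\<bar>exp (c * pad_mat A p)\<bar> \<le> exp \<bar>c\<bar>" by simp
qed measurable

end

context haar_linear_form
begin

text \<open>The weight \<open>exp (t * form)\<close> lies between \<open>exp (- t * norm1)\<close> and \<open>exp (t * norm1)\<close>, whereas by
  \<open>entry_exp_moment\<close> an entry exceeds \<open>\<epsilon>\<close> only with probability of order
  \<open>exp (- \<epsilon>\<^sup>2 * (N - 1) / 2)\<close>. So for \<open>t\<close> small compared to \<open>N\<close> the weight cannot make an entry large.\<close>

lemma entry_sq_exp_bound:
  assumes N: "N \<ge> 2" and t: "0 \<le> t" "t \<le> T" and eps: "\<epsilon> > 0"
  shows "(\<integral>A. (pad_mat A p)\<^sup>2 * exp (t * form A) \<partial>\<mu>)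
    \<le> (\<epsilon>\<^sup>2 + 2 * exp (2 * T * norm1 - \<epsilon>\<^sup>2 * (real N - 1) / 2)) * mgf t"
proof -
  \<comment> \<open>The optimal parameter in Chernoff's bound for the tail of an entry beyond \<open>\<epsilon>\<close>.\<close>
  define c where "c = \<epsilon> * (real N - 1)"
  have c: "c \<ge> 0" using N eps by (simp add: c_def)
  have point: "(pad_mat A p)\<^sup>2 * exp (t * form A) \<le> \<epsilon>\<^sup>2 * exp (t * form A)
      + exp (t * norm1 - c * \<epsilon>) * (exp (c * pad_mat A p) + exp (- c * pad_mat A p))"
    if A: "A \<in> space \<mu>" for A
  proof (cases "\<bar>pad_mat A p\<bar> \<le> \<epsilon>")
    case True
    then have "(pad_mat A p)\<^sup>2 * exp (t * form A) \<le> \<epsilon>\<^sup>2 * exp (t * form A)"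
      using eps by (simp add: abs_le_square_iff[symmetric])
    then show ?thesis by (simp add: add_increasing2)
  next
    case False
    have "(pad_mat A p)\<^sup>2 * exp (t * form A) \<le> 1 * exp (t * norm1)"
      using abs_t_form_le(1)[OF A, of t] t abs_entry_le_1[OF A, of p]
      by (intro mult_mono) (auto simp: abs_square_le_1)
    also have "\<dots> \<le> exp (t * norm1 - c * \<epsilon>) * exp (c * \<bar>pad_mat A p\<bar>)"
      using False c by (simp add: exp_add[symmetric] mult_left_mono)
    also have "\<dots> \<le> exp (t * norm1 - c * \<epsilon>) * (exp (c * pad_mat A p) + exp (- c * pad_mat A p))"
      by (intro mult_left_mono) (auto simp: abs_if)
    finally show ?thesis by (simp add: add_increasing)
  qed
  have "(\<integral>A. (pad_mat A p)\<^sup>2 * exp (t * form A) \<partial>\<mu>) \<le> (\<integral>A. \<epsilon>\<^sup>2 * exp (t * form A)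
      + exp (t * norm1 - c * \<epsilon>) * (exp (c * pad_mat A p) + exp (- c * pad_mat A p)) \<partial>\<mu>)"
  proof (rule integral_mono[OF _ _ point])
    show "integrable \<mu> (\<lambda>A. (pad_mat A p)\<^sup>2 * exp (t * form A))"
      using abs_entry_le_1 by (intro integrable_bounded_times_exp[where K = 1]) (auto simp: abs_square_le_1)
  qed (intro Bochner_Integration.integrable_add integrable_mult_right integrable_exp integrable_entry_exp)
  also have "\<dots> = \<epsilon>\<^sup>2 * mgf t + exp (t * norm1 - c * \<epsilon>) *
      ((\<integral>A. exp (c * pad_mat A p) \<partial>\<mu>) + (\<integral>A. exp (- c * pad_mat A p) \<partial>\<mu>))"
    using integrable_exp[of t] integrable_entry_exp[of c p] integrable_entry_exp[of "- c" p]
    by (simp add: mgf_def)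
  also have "\<dots> \<le> \<epsilon>\<^sup>2 * mgf t + exp (t * norm1 - c * \<epsilon>) * (2 * exp (c\<^sup>2 / (2 * (real N - 1))))"
    using entry_exp_moment[OF N, of c p] entry_exp_moment[OF N, of "- c" p]
    by (intro add_left_mono mult_left_mono) auto
  also have "exp (t * norm1 - c * \<epsilon>) * (2 * exp (c\<^sup>2 / (2 * (real N - 1))))
      = 2 * exp (2 * t * norm1 - \<epsilon>\<^sup>2 * (real N - 1) / 2) * exp (- (\<bar>t\<bar> * norm1))"
  proof -
    have "(\<epsilon> * n)\<^sup>2 / (2 * n) = \<epsilon>\<^sup>2 * n / 2" if "n > 0" for n :: real
      using that by (simp add: power2_eq_square)
    then have m: "c\<^sup>2 / (2 * (real N - 1)) = \<epsilon>\<^sup>2 * (real N - 1) / 2"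
      unfolding c_def using N by (metis diff_gt_0_iff_gt of_nat_1 of_nat_less_iff numeral_2_eq_2 Suc_le_lessD One_nat_def)
    have n: "c * \<epsilon> = \<epsilon>\<^sup>2 * (real N - 1)"
      by (simp add: c_def power2_eq_square)
    have "t * norm1 - c * \<epsilon> + c\<^sup>2 / (2 * (real N - 1))
        = 2 * t * norm1 - \<epsilon>\<^sup>2 * (real N - 1) / 2 + - (\<bar>t\<bar> * norm1)"
      unfolding m n using t by (simp add: field_simps)
    then show ?thesis
      by (simp only: mult.left_commute[of _ 2] mult.assoc exp_add[symmetric])
  qed
  also have "\<epsilon>\<^sup>2 * mgf t + 2 * exp (2 * t * norm1 - \<epsilon>\<^sup>2 * (real N - 1) / 2) * exp (- (\<bar>t\<bar> * norm1))
      \<le> \<epsilon>\<^sup>2 * mgf t + 2 * exp (2 * T * norm1 - \<epsilon>\<^sup>2 * (real N - 1) / 2) * mgf t"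
    using mgf_ge[of t] t norm1_nonneg
    by (intro add_left_mono mult_mono) (auto intro: mult_right_mono)
  finally show ?thesis by (simp add: algebra_simps)
qed

text \<open>Each summand of the remainder contains a product of two entries of \<open>A\<close>, which is bounded by the
  mean of their squares.\<close>

lemma remainder_exp_bound:
  assumes \<delta>: "\<And>p. (\<integral>A. (pad_mat A p)\<^sup>2 * exp (t * form A) \<partial>\<mu>) \<le> \<delta> * mgf t"
  shows "\<bar>\<integral>A. remainder A * exp (t * form A) \<partial>\<mu>\<bar> \<le> norm1\<^sup>2 * \<delta> * mgf t"
proof -
  have int_sq: "integrable \<mu> (\<lambda>A. (pad_mat A p)\<^sup>2 * exp (t * form A))" for p
    using abs_entry_le_1 by (intro integrable_bounded_times_exp[where K = 1]) (auto simp: abs_square_le_1)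
  have point: "\<bar>remainder A\<bar> \<le> (\<Sum>a<N. \<Sum>b<N. \<Sum>j<N. \<Sum>l<N. \<bar>\<theta> (a, j)\<bar> * \<bar>\<theta> (b, l)\<bar> *
      (((pad_mat A (b, j))\<^sup>2 + (pad_mat A (a, l))\<^sup>2) / 2))" for A
  proof -
    have "\<bar>remainder A\<bar> \<le> (\<Sum>a<N. \<Sum>b<N. \<Sum>j<N. \<Sum>l<N.
        \<bar>\<theta> (a, j) * pad_mat A (b, j) * (\<theta> (b, l) * pad_mat A (a, l))\<bar>)"
      unfolding remainder_def pairing_def sum_product
      by (intro order_trans[OF sum_abs] sum_mono order_refl)
    also have "\<dots> \<le> (\<Sum>a<N. \<Sum>b<N. \<Sum>j<N. \<Sum>l<N. \<bar>\<theta> (a, j)\<bar> * \<bar>\<theta> (b, l)\<bar> *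
      (((pad_mat A (b, j))\<^sup>2 + (pad_mat A (a, l))\<^sup>2) / 2))"
    proof (intro sum_mono)
      fix a b j l
      have "\<bar>x * y\<bar> \<le> (x\<^sup>2 + y\<^sup>2) / 2" for x y :: real
        using zero_le_power2[of "\<bar>x\<bar> - \<bar>y\<bar>"] by (simp add: power2_diff abs_mult)
      from mult_left_mono[OF this[of "pad_mat A (b, j)" "pad_mat A (a, l)"],
          of "\<bar>\<theta> (a, j)\<bar> * \<bar>\<theta> (b, l)\<bar>"]
      show "\<bar>\<theta> (a, j) * pad_mat A (b, j) * (\<theta> (b, l) * pad_mat A (a, l))\<bar>
        \<le> \<bar>\<theta> (a, j)\<bar> * \<bar>\<theta> (b, l)\<bar> * (((pad_mat A (b, j))\<^sup>2 + (pad_mat A (a, l))\<^sup>2) / 2)"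
        by (simp add: abs_mult mult_ac)
    qed
    finally show ?thesis .
  qed
  have "\<bar>\<integral>A. remainder A * exp (t * form A) \<partial>\<mu>\<bar> \<le> (\<integral>A. \<bar>remainder A * exp (t * form A)\<bar> \<partial>\<mu>)"
    by (rule integral_abs_bound)
  also have "\<dots> \<le> (\<integral>A. (\<Sum>a<N. \<Sum>b<N. \<Sum>j<N. \<Sum>l<N. \<bar>\<theta> (a, j)\<bar> * \<bar>\<theta> (b, l)\<bar> *
      (((pad_mat A (b, j))\<^sup>2 * exp (t * form A) + (pad_mat A (a, l))\<^sup>2 * exp (t * form A)) / 2)) \<partial>\<mu>)"
  proof (rule integral_mono)
    fix A
    show "\<bar>remainder A * exp (t * form A)\<bar> \<le> (\<Sum>a<N. \<Sum>b<N. \<Sum>j<N. \<Sum>l<N. \<bar>\<theta> (a, j)\<bar> * \<bar>\<theta> (b, l)\<bar> *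
      (((pad_mat A (b, j))\<^sup>2 * exp (t * form A) + (pad_mat A (a, l))\<^sup>2 * exp (t * form A)) / 2))"
      using mult_right_mono[OF point[of A], of "exp (t * form A)"]
      by (simp add: abs_mult sum_distrib_right distrib_right mult.assoc)
  qed (intro integrable_abs integrable_remainder_exp Bochner_Integration.integrable_sum
      integrable_mult_right integrable_divide_zero Bochner_Integration.integrable_add int_sq)+
  also have "\<dots> = (\<Sum>a<N. \<Sum>b<N. \<Sum>j<N. \<Sum>l<N. \<bar>\<theta> (a, j)\<bar> * \<bar>\<theta> (b, l)\<bar> *
      (((\<integral>A. (pad_mat A (b, j))\<^sup>2 * exp (t * form A) \<partial>\<mu>)
        + (\<integral>A. (pad_mat A (a, l))\<^sup>2 * exp (t * form A) \<partial>\<mu>)) / 2))"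
    using int_sq by simp
  also have "\<dots> \<le> (\<Sum>a<N. \<Sum>b<N. \<Sum>j<N. \<Sum>l<N. \<bar>\<theta> (a, j)\<bar> * \<bar>\<theta> (b, l)\<bar> * (\<delta> * mgf t))"
  proof (intro sum_mono mult_left_mono)
    fix a b j l
    have mean: "(x + y) / 2 \<le> z" if "x \<le> z" "y \<le> z" for x y z :: real
      using that by (simp add: field_simps)
    show "((\<integral>A. (pad_mat A (b, j))\<^sup>2 * exp (t * form A) \<partial>\<mu>)
        + (\<integral>A. (pad_mat A (a, l))\<^sup>2 * exp (t * form A) \<partial>\<mu>)) / 2 \<le> \<delta> * mgf t"
      by (rule mean) (rule \<delta>)+
  qed auto
  also have "\<dots> = norm1\<^sup>2 * \<delta> * mgf t"
  proof -
    have "norm1\<^sup>2 = (\<Sum>a<N. \<Sum>b<N. \<Sum>j<N. \<Sum>l<N. \<bar>\<theta> (a, j)\<bar> * \<bar>\<theta> (b, l)\<bar>)"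
      by (simp only: norm1_def power2_eq_square sum_product)
    then show ?thesis
      by (simp add: sum_distrib_right mult.assoc)
  qed
  finally show ?thesis .
qed

text \<open>The resulting Gaussian estimate for the Laplace transform, valid for each \<open>N\<close>. With \<open>T = N / \<beta>\<close>
  and \<open>\<beta> \<longlonglongrightarrow> \<infinity>\<close> the error \<open>\<delta>\<close> can be made arbitrarily small through \<open>\<epsilon>\<close>.\<close>

lemma mgf_bounds:
  assumes N: "N \<ge> 2" and T: "T \<ge> 0" and eps: "\<epsilon> > 0"
  defines "\<delta> \<equiv> norm1\<^sup>2 * (\<epsilon>\<^sup>2 + 2 * exp (2 * T * norm1 - \<epsilon>\<^sup>2 * (real N - 1) / 2))"
  shows "mgf T \<le> exp ((normsq + \<delta>) * T\<^sup>2 / (2 * (real N - 1)))"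
    and "exp ((normsq - \<delta>) * T\<^sup>2 / (2 * (real N - 1))) \<le> mgf T"
proof -
  have R: "\<bar>\<integral>A. remainder A * exp (t * form A) \<partial>\<mu>\<bar> \<le> \<delta> * mgf t" if "0 \<le> t" "t \<le> T" for t
    unfolding \<delta>_def by (rule remainder_exp_bound) (rule entry_sq_exp_bound[OF N that eps])
  show "mgf T \<le> exp ((normsq + \<delta>) * T\<^sup>2 / (2 * (real N - 1)))"
    using R by (intro mgf_upper_bound[OF N T]) (force simp: abs_le_iff)
  show "exp ((normsq - \<delta>) * T\<^sup>2 / (2 * (real N - 1))) \<le> mgf T"
    using R by (intro mgf_lower_bound[OF N T]) (force simp: abs_le_iff)
qed

end

section \<open>Asymptotics and the large deviation principle\<close>

lemma J_eq_half_sq_norm: "J = half_sq_norm"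
proof
  fix A
  have "(\<lambda>(i, j). ennreal ((A (i, j))\<^sup>2)) = (\<lambda>p :: nat \<times> nat. ennreal ((A p)\<^sup>2))"
    by (simp add: case_prod_unfold)
  then show "J A = half_sq_norm A"
    by (simp only: J_def frobenius_sq_def half_sq_norm_def)
qed

lemma sum_box_eq_sum_support:
  fixes f :: "nat \<times> nat \<Rightarrow> real"
  assumes "S \<subseteq> {..<N} \<times> {..<N}" "\<And>p. p \<notin> S \<Longrightarrow> f p = 0"
  shows "(\<Sum>a<N. \<Sum>j<N. f (a, j)) = (\<Sum>p\<in>S. f p)"
proof -
  have "(\<Sum>a<N. \<Sum>j<N. f (a, j)) = (\<Sum>p\<in>{..<N} \<times> {..<N}. f p)"
    by (simp add: sum.cartesian_product)
  also have "\<dots> = (\<Sum>p\<in>S. f p)"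
    using assms by (intro sum.mono_neutral_right) auto
  finally show ?thesis .
qed

text \<open>This is where \<open>\<beta> \<longlonglongrightarrow> \<infinity>\<close> enters: the Chernoff exponent of order \<open>N\<close> beats \<open>N / \<beta>\<close>.\<close>

lemma large_entry_error_tendsto_0:
  fixes \<beta> :: "nat \<Rightarrow> real"
  assumes \<beta>: "filterlim \<beta> at_top sequentially" and eps: "\<epsilon> > 0"
  shows "(\<lambda>N. exp (2 * (real N / \<beta> N) * C - \<epsilon>\<^sup>2 * (real N - 1) / 2)) \<longlonglongrightarrow> 0"
proof -
  have "(\<lambda>N. inverse (\<beta> N)) \<longlonglongrightarrow> 0"
    by (rule tendsto_inverse_0_at_top[OF \<beta>])
  then have "(\<lambda>N. 2 * C * inverse (\<beta> N) - \<epsilon>\<^sup>2 / 2 + \<epsilon>\<^sup>2 / 2 * inverse (real N))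
      \<longlonglongrightarrow> 2 * C * 0 - \<epsilon>\<^sup>2 / 2 + \<epsilon>\<^sup>2 / 2 * 0"
    by (intro tendsto_intros lim_inverse_n)
  then have "filterlim (\<lambda>N. (2 * C * inverse (\<beta> N) - \<epsilon>\<^sup>2 / 2 + \<epsilon>\<^sup>2 / 2 * inverse (real N)) * real N)
      at_bot sequentially"
    using eps by (intro filterlim_tendsto_neg_mult_at_bot[where c = "2 * C * 0 - \<epsilon>\<^sup>2 / 2 + \<epsilon>\<^sup>2 / 2 * 0"]
      filterlim_real_sequentially) auto
  then have "(\<lambda>N. exp ((2 * C * inverse (\<beta> N) - \<epsilon>\<^sup>2 / 2 + \<epsilon>\<^sup>2 / 2 * inverse (real N)) * real N))
      \<longlonglongrightarrow> 0"
    by (rule filterlim_compose[OF exp_at_bot])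
  also have "?this \<longleftrightarrow> (\<lambda>N. exp (2 * (real N / \<beta> N) * C - \<epsilon>\<^sup>2 * (real N - 1) / 2)) \<longlonglongrightarrow> 0"
  proof (rule tendsto_cong)
    show "\<forall>\<^sub>F N in sequentially. exp ((2 * C * inverse (\<beta> N) - \<epsilon>\<^sup>2 / 2 + \<epsilon>\<^sup>2 / 2 * inverse (real N)) * real N)
        = exp (2 * (real N / \<beta> N) * C - \<epsilon>\<^sup>2 * (real N - 1) / 2)"
      using eventually_ge_at_top[of 1]
    proof eventually_elim
      case (elim N)
      have "(2 * C * b - e / 2 + e / 2 * inverse n) * n = 2 * (n * b) * C - e * (n - 1) / 2"
        if "n \<noteq> 0" for b e n :: real
        using that by (simp add: field_simps)
      from this[of "real N" "inverse (\<beta> N)" "\<epsilon>\<^sup>2"] elim show ?case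
        by (simp only: divide_inverse[of "real N"])
    qed
  qed
  finally show "(\<lambda>N. exp (2 * (real N / \<beta> N) * C - \<epsilon>\<^sup>2 * (real N - 1) / 2)) \<longlonglongrightarrow> 0" .
qed

text \<open>The passage from the estimate \<open>mgf_bounds\<close>, with \<open>T = N / \<beta>\<close>, to the limit of the scaled
  logarithm: \<open>T\<^sup>2 / (N - 1)\<close> is the speed \<open>N / \<beta>\<^sup>2\<close> up to a factor tending to 1, and the
  error in the exponent tends to \<open>C\<^sup>2 * \<epsilon>\<^sup>2\<close> for every \<open>\<epsilon>\<close>.\<close>

lemma log_mgf_limit:
  fixes L \<beta> :: "nat \<Rightarrow> real"
  assumes pos: "\<And>N. N \<ge> 1 \<Longrightarrow> \<beta> N > 0" and \<beta>: "filterlim \<beta> at_top sequentially"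
    and V: "V \<ge> 0"
    and bounds: "\<And>\<epsilon>. \<epsilon> > 0 \<Longrightarrow> \<forall>\<^sub>F N in sequentially.
      exp ((V - C\<^sup>2 * (\<epsilon>\<^sup>2 + 2 * exp (2 * (real N / \<beta> N) * C - \<epsilon>\<^sup>2 * (real N - 1) / 2)))
        * (real N / \<beta> N)\<^sup>2 / (2 * (real N - 1))) \<le> L N \<and>
      L N \<le> exp ((V + C\<^sup>2 * (\<epsilon>\<^sup>2 + 2 * exp (2 * (real N / \<beta> N) * C - \<epsilon>\<^sup>2 * (real N - 1) / 2)))
        * (real N / \<beta> N)\<^sup>2 / (2 * (real N - 1)))"
  shows "(\<lambda>N. ln (L N) / (real N / (\<beta> N)\<^sup>2)) \<longlonglongrightarrow> V / 2"
proof (rule tendstoI)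
  fix r :: real assume r: "r > 0"
  define \<epsilon> where "\<epsilon> = sqrt r / (\<bar>C\<bar> + 1)"
  have eps: "\<epsilon> > 0" using r by (simp add: \<epsilon>_def)
  have small: "C\<^sup>2 * \<epsilon>\<^sup>2 < r"
  proof -
    have "\<bar>C\<bar>\<^sup>2 < (\<bar>C\<bar> + 1)\<^sup>2" by (intro power_strict_mono) auto
    moreover have "C\<^sup>2 * \<epsilon>\<^sup>2 = r * (\<bar>C\<bar>\<^sup>2 / (\<bar>C\<bar> + 1)\<^sup>2)"
      using r by (simp add: \<epsilon>_def power_divide)
    ultimately show ?thesis
      using r by (simp add: divide_less_eq)
  qed
  define \<delta> where "\<delta> = (\<lambda>N. C\<^sup>2 * (\<epsilon>\<^sup>2 + 2 * exp (2 * (real N / \<beta> N) * C - \<epsilon>\<^sup>2 * (real N - 1) / 2)))"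
  define q where "q = (\<lambda>N. real N / (real N - 1))"
  have q: "q \<longlonglongrightarrow> 1"
    unfolding q_def by real_asymp
  have \<delta>: "\<delta> \<longlonglongrightarrow> C\<^sup>2 * (\<epsilon>\<^sup>2 + 2 * 0)"
    unfolding \<delta>_def by (intro tendsto_intros large_entry_error_tendsto_0[OF \<beta> eps])
  have "(\<lambda>N. V / 2 * \<bar>q N - 1\<bar> + \<delta> N / 2 * q N) \<longlonglongrightarrow> V / 2 * \<bar>1 - 1\<bar> + C\<^sup>2 * (\<epsilon>\<^sup>2 + 2 * 0) / 2 * 1"
    by (intro tendsto_intros q \<delta>) simp
  moreover have "V / 2 * \<bar>1 - 1\<bar> + C\<^sup>2 * (\<epsilon>\<^sup>2 + 2 * 0) / 2 * 1 < r"
    using small r by simp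
  ultimately have "\<forall>\<^sub>F N in sequentially. V / 2 * \<bar>q N - 1\<bar> + \<delta> N / 2 * q N < r"
    by (rule order_tendstoD)
  with bounds[OF eps] eventually_ge_at_top[of 2]
  show "\<forall>\<^sub>F N in sequentially. dist (ln (L N) / (real N / (\<beta> N)\<^sup>2)) (V / 2) < r"
  proof eventually_elim
    case (elim N)
    define u where "u = real N / (\<beta> N)\<^sup>2"
    have u: "u > 0" using elim(2) pos[of N] by (simp add: u_def)
    have T: "(real N / \<beta> N)\<^sup>2 / (2 * (real N - 1)) = u * (q N / 2)"
      by (simp add: u_def q_def power2_eq_square)
    have lo: "exp ((V - \<delta> N) * (u * (q N / 2))) \<le> L N" and up: "L N \<le> exp ((V + \<delta> N) * (u * (q N / 2)))"
      using elim(1) unfolding \<delta>_def[symmetric] times_divide_eq_right[symmetric] T by (auto simp: \<delta>_def)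
    have L: "L N > 0" using lo exp_gt_zero less_le_trans by blast
    have "(V - \<delta> N) * (u * (q N / 2)) \<le> ln (L N)"
      using lo by (simp only: ln_ge_iff[OF L])
    moreover have "ln (L N) \<le> (V + \<delta> N) * (u * (q N / 2))"
      using up L ln_le_cancel_iff[of "L N" "exp ((V + \<delta> N) * (u * (q N / 2)))"] by simp
    ultimately have "(V - \<delta> N) * (q N / 2) \<le> ln (L N) / u" "ln (L N) / u \<le> (V + \<delta> N) * (q N / 2)"
      using u by (simp_all add: pos_le_divide_eq pos_divide_le_eq mult_ac)
    moreover have "\<bar>x - V / 2 - V / 2 * (r - 1)\<bar> \<le> d / 2 * r"
      if "(V - d) * (r / 2) \<le> x" "x \<le> (V + d) * (r / 2)" for x r d :: real
      using that by (auto simp: abs_le_iff field_simps)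
    ultimately have "\<bar>ln (L N) / u - V / 2 - V / 2 * (q N - 1)\<bar> \<le> \<delta> N / 2 * q N"
      by blast
    moreover have "\<bar>V / 2 * (q N - 1)\<bar> = V / 2 * \<bar>q N - 1\<bar>"
      using V by (simp add: abs_mult)
    ultimately have "\<bar>ln (L N) / u - V / 2\<bar> < r"
      using elim(3) by linarith
    then show ?case
      by (simp add: u_def dist_real_def)
  qed
qed

lemma speed_at_top:
  fixes \<beta> :: "nat \<Rightarrow> real"
  assumes pos: "\<And>N. N \<ge> 1 \<Longrightarrow> \<beta> N > 0" and o: "\<beta> \<in> o(\<lambda>N. sqrt (real N))"
  shows "filterlim (\<lambda>N. real N / (\<beta> N)\<^sup>2) at_top sequentially"
proof -
  have "(\<lambda>N. \<beta> N / sqrt (real N)) \<longlonglongrightarrow> 0"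
    using smalloD_tendsto[OF o] .
  from tendsto_power[OF this, of 2] have "(\<lambda>N. (\<beta> N / sqrt (real N))\<^sup>2) \<longlonglongrightarrow> 0"
    by simp
  moreover have "\<forall>\<^sub>F N in sequentially. (\<beta> N / sqrt (real N))\<^sup>2 > 0"
    using eventually_ge_at_top[of 1]
    by eventually_elim (use pos in \<open>force\<close>)
  ultimately have "filterlim (\<lambda>N. inverse ((\<beta> N / sqrt (real N))\<^sup>2)) at_top sequentially"
    by (rule filterlim_inverse_at_top)
  then show ?thesis
    by (simp add: power_divide)
qed

theorem theorem3:
  fixes M :: "nat \<Rightarrow> 'w measure"
    and A :: "nat \<Rightarrow> 'w \<Rightarrow> real mat"
    and \<beta> :: "nat \<Rightarrow> real"
  assumes "\<And>N. N \<ge> 1 \<Longrightarrow> prob_space (M N)"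
    and "\<And>N. N \<ge> 1 \<Longrightarrow> uniform_orthogonal (M N) N (A N)"
    and "\<And>N. N \<ge> 1 \<Longrightarrow> \<beta> N > 0"
    and "filterlim \<beta> at_top sequentially"
    and "\<beta> \<in> o(\<lambda>N. sqrt (real N))"
  shows "satisfies_LDP M (\<lambda>N w p. \<beta> N * pad_mat (A N w) p) (\<lambda>N. real N / (\<beta> N)\<^sup>2) J \<and>
         good_rate_function J \<and> convex_matrix_fun J"
proof -
  define s where "s = (\<lambda>N. real N / (\<beta> N)\<^sup>2)"
  define X where "X = (\<lambda>N w p. \<beta> N * pad_mat (A N w) p)"
  define \<mu> where "\<mu> = (\<lambda>N. distr (M N) (borel_orthogonal N) (A N))"
  have A_meas: "A N \<in> M N \<rightarrow>\<^sub>M borel_orthogonal N" and haar: "haar_measure (\<mu> N) N" if "N \<ge> 1" for N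
    using assms(2)[OF that] by (auto simp: uniform_orthogonal_def \<mu>_def intro: haar_measureI)
  have transfer: "(\<integral>w. f (A N w) \<partial>M N) = (\<integral>B. f B \<partial>\<mu> N)"
    if "N \<ge> 1" "f \<in> borel_measurable (\<mu> N)" for N and f :: "real mat \<Rightarrow> real"
    using integral_distr[OF A_meas[OF that(1)], of f] that(2) by (simp add: \<mu>_def)
  have entry_meas: "(\<lambda>B. pad_mat B p) \<in> borel_measurable (\<mu> N)" if "N \<ge> 1" for N p
    by (rule haar_measure.entry_measurable[OF haar[OF that]])
  have entry_meas': "(\<lambda>w. pad_mat (A N w) p) \<in> borel_measurable (M N)" if "N \<ge> 1" for N p
    using measurable_compose[OF A_meas[OF that], of "\<lambda>B. pad_mat B p" borel] entry_meas[OF that, of p]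
    by (simp add: \<mu>_def)
  have in_group: "A N w \<in> orthogonal_group N" if "N \<ge> 1" "w \<in> space (M N)" for N w
    using measurable_space[OF A_meas[OF that(1)] that(2)] by (simp add: borel_orthogonal_def)
  have scale: "s N * (\<Sum>p\<in>S. \<theta> p * X N w p) = real N / \<beta> N * (\<Sum>p\<in>S. \<theta> p * pad_mat (A N w) p)"
    if "N \<ge> 1" for N S \<theta> w
  proof -
    have "(\<Sum>p\<in>S. \<theta> p * X N w p) = \<beta> N * (\<Sum>p\<in>S. \<theta> p * pad_mat (A N w) p)"
      by (simp add: X_def sum_distrib_left mult_ac)
    moreover have "s N * \<beta> N = real N / \<beta> N"
      using assms(3)[OF that] by (simp add: s_def power2_eq_square)
    ultimately show ?thesis by (simp add: mult.assoc[symmetric])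
  qed
  have "quadratic_exp_moments M X s"
  proof (rule quadratic_exp_moments.intro)
    show "prob_space (M N)" if "N \<ge> 1" for N
      by (rule assms(1)[OF that])
    show "X N \<in> borel_measurable (M N)" if "N \<ge> 1" for N
      unfolding X_def
      by (intro measurable_coordinatewise_then_product borel_measurable_times
          borel_measurable_const entry_meas'[OF that])
    show "filterlim s at_top sequentially"
      unfolding s_def by (rule speed_at_top[OF assms(3,5)])
    show "integrable (M N) (\<lambda>w. exp (s N * (\<Sum>p\<in>S. \<theta> p * X N w p)))"
      if N: "N \<ge> 1" and S: "finite S" for N S \<theta>
    proof -
      interpret prob_space "M N" by (rule assms(1)[OF N])
      let ?c = "\<Sum>p\<in>S. \<bar>\<theta> p\<bar>"
      have "\<bar>\<Sum>p\<in>S. \<theta> p * pad_mat (A N w) p\<bar> \<le> ?c" if w: "w \<in> space (M N)" for w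
      proof (rule order_trans[OF sum_abs sum_mono])
        fix p
        show "\<bar>\<theta> p * pad_mat (A N w) p\<bar> \<le> \<bar>\<theta> p\<bar>"
          using mult_left_mono[OF abs_pad_mat_le_1[OF in_group[OF N w], of p], of "\<bar>\<theta> p\<bar>"]
          by (simp add: abs_mult)
      qed
      moreover have "real N / \<beta> N \<ge> 0" using assms(3)[OF N] by simp
      ultimately have "real N / \<beta> N * (\<Sum>p\<in>S. \<theta> p * pad_mat (A N w) p) \<le> real N / \<beta> N * ?c"
        if "w \<in> space (M N)" for w
        using that by (intro mult_left_mono) (auto simp: abs_le_iff)
      then show ?thesis
        unfolding scale[OF N]
        using entry_meas'[OF N] by (intro integrable_const_bound[where B = "exp (real N / \<beta> N * ?c)"]) auto
    qed
    fix S :: "(nat \<times> nat) set" and \<theta> :: "nat \<times> nat \<Rightarrow> real"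
    assume S: "finite S"
    have "(\<lambda>N. ln (\<integral>w. exp (s N * (\<Sum>p\<in>S. \<theta> p * X N w p)) \<partial>M N) / (real N / (\<beta> N)\<^sup>2))
        \<longlonglongrightarrow> (\<Sum>p\<in>S. (\<theta> p)\<^sup>2) / 2"
    proof (rule log_mgf_limit[OF assms(3,4), where C = "\<Sum>p\<in>S. \<bar>\<theta> p\<bar>"])
      fix \<epsilon> :: real assume eps: "\<epsilon> > 0"
      define \<psi> where "\<psi> = (\<lambda>p. if p \<in> S then \<theta> p else 0)"
      \<comment> \<open>From \<open>N = k\<close> on, the finite support of the linear form fits into an \<open>N \<times> N\<close> matrix.\<close>
      define k where "k = Suc (Max (insert 0 (fst ` S \<union> snd ` S)))"
      have box: "S \<subseteq> {..<N} \<times> {..<N}" if "N \<ge> k" for N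
      proof
        fix p assume "p \<in> S"
        then have "fst p \<le> Max (insert 0 (fst ` S \<union> snd ` S))" "snd p \<le> Max (insert 0 (fst ` S \<union> snd ` S))"
          using S by (auto intro!: Max_ge)
        then show "p \<in> {..<N} \<times> {..<N}"
          using that by (cases p) (auto simp: k_def)
      qed
      show "\<forall>\<^sub>F N in sequentially.
        exp (((\<Sum>p\<in>S. (\<theta> p)\<^sup>2) - (\<Sum>p\<in>S. \<bar>\<theta> p\<bar>)\<^sup>2 * (\<epsilon>\<^sup>2 + 2 * exp (2 * (real N / \<beta> N) * (\<Sum>p\<in>S. \<bar>\<theta> p\<bar>) - \<epsilon>\<^sup>2 * (real N - 1) / 2)))
          * (real N / \<beta> N)\<^sup>2 / (2 * (real N - 1))) \<le> (\<integral>w. exp (s N * (\<Sum>p\<in>S. \<theta> p * X N w p)) \<partial>M N) \<and>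
        (\<integral>w. exp (s N * (\<Sum>p\<in>S. \<theta> p * X N w p)) \<partial>M N) \<le> exp (((\<Sum>p\<in>S. (\<theta> p)\<^sup>2) + (\<Sum>p\<in>S. \<bar>\<theta> p\<bar>)\<^sup>2 * (\<epsilon>\<^sup>2 + 2 * exp (2 * (real N / \<beta> N) * (\<Sum>p\<in>S. \<bar>\<theta> p\<bar>) - \<epsilon>\<^sup>2 * (real N - 1) / 2)))
          * (real N / \<beta> N)\<^sup>2 / (2 * (real N - 1)))"
        using eventually_ge_at_top[of "max 2 k"]
      proof eventually_elim
        case (elim N)
        then have N: "N \<ge> 1" "N \<ge> 2" and k: "N \<ge> k" by auto
        interpret haar_measure "\<mu> N" N by (rule haar[OF N(1)])
        interpret haar_linear_form "\<mu> N" N \<psi> ..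
        have form: "form B = (\<Sum>p\<in>S. \<theta> p * pad_mat B p)" for B
          unfolding form_def pairing_def
          using sum_box_eq_sum_support[OF box[OF k], of "\<lambda>p. \<psi> p * pad_mat B p"]
          by (simp add: \<psi>_def)
        have norm1: "norm1 = (\<Sum>p\<in>S. \<bar>\<theta> p\<bar>)"
          unfolding norm1_def using sum_box_eq_sum_support[OF box[OF k], of "\<lambda>p. \<bar>\<psi> p\<bar>"]
          by (simp add: \<psi>_def)
        have normsq: "normsq = (\<Sum>p\<in>S. (\<theta> p)\<^sup>2)"
          unfolding normsq_def using sum_box_eq_sum_support[OF box[OF k], of "\<lambda>p. (\<psi> p)\<^sup>2"]
          by (simp add: \<psi>_def)
        have "(\<integral>w. exp (s N * (\<Sum>p\<in>S. \<theta> p * X N w p)) \<partial>M N) = mgf (real N / \<beta> N)"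
          unfolding scale[OF N(1)] mgf_def form
          by (rule transfer[OF N(1)]) measurable
        moreover have "real N / \<beta> N \<ge> 0" using assms(3)[OF N(1)] by simp
        ultimately show ?case
          using mgf_bounds[OF N(2) _ eps, of "real N / \<beta> N"] by (simp only: norm1 normsq simp_thms)
      qed
    qed (simp_all add: sum_nonneg)
    then show "(\<lambda>N. ln (\<integral>w. exp (s N * (\<Sum>p\<in>S. \<theta> p * X N w p)) \<partial>M N) / s N)
        \<longlonglongrightarrow> (\<Sum>p\<in>S. (\<theta> p)\<^sup>2) / 2"
      by (simp only: s_def)
  next
    show "\<forall>\<^sub>F N in sequentially. \<forall>p c. (\<integral>w. exp (s N * (c * X N w p)) \<partial>M N) \<le> exp (s N * c\<^sup>2)"
      using eventually_ge_at_top[of 2]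
    proof eventually_elim
      case (elim N)
      then have N: "N \<ge> 1" by simp
      interpret haar_measure "\<mu> N" N by (rule haar[OF N])
      show ?case
      proof (intro allI)
        fix p c
        have "(\<integral>w. exp (s N * (c * X N w p)) \<partial>M N) = (\<integral>w. exp (real N / \<beta> N * c * pad_mat (A N w) p) \<partial>M N)"
          using scale[OF N, where S = "{p}" and \<theta> = "\<lambda>_. c"] by (simp add: mult.assoc)
        also have "\<dots> = (\<integral>B. exp (real N / \<beta> N * c * pad_mat B p) \<partial>\<mu> N)"
          by (rule transfer[OF N]) measurable
        also have "\<dots> \<le> exp ((real N / \<beta> N * c)\<^sup>2 / (2 * (real N - 1)))"
          by (rule entry_exp_moment[OF elim])
        also have "\<dots> \<le> exp (s N * c\<^sup>2)"
        proof -
          have "(real N / \<beta> N * c)\<^sup>2 / (2 * (real N - 1)) = s N * c\<^sup>2 * (real N / (2 * (real N - 1)))"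
            by (simp add: s_def power2_eq_square)
          also have "\<dots> \<le> s N * c\<^sup>2 * 1"
            using elim by (intro mult_left_mono) (auto simp: s_def)
          finally show ?thesis by simp
        qed
        finally show "(\<integral>w. exp (s N * (c * X N w p)) \<partial>M N) \<le> exp (s N * c\<^sup>2)" .
      qed
    qed
  qed
  then have "satisfies_LDP M X s half_sq_norm"
    by (rule quadratic_exp_moments.satisfies_LDP_half_sq_norm)
  then show ?thesis
    using good_rate_function_half_sq_norm half_sq_norm_convex
    unfolding J_eq_half_sq_norm convex_matrix_fun_def X_def s_def by blast
qed

end
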